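(* Let $\Phi=(A;\{E_i\}_{i=0}^d;A^*;\{E^*_i\}_{i=0}^d)$ be a Leonard system in $\mathcal{A}$ with parameter array $(\{\theta_i\}_{i=0}^d;\{\theta^*_i\}_{i=0}^d;\{\varphi_i\}_{i=1}^d;\{\phi_i\}_{i=1}^d)$, and let $\xi_0\in E_0V$, $\xi_d\in E_dV$, $\xi^*_0\in E^*_0V$, $\xi^*_d\in E^*_dV$ be nonzero vectors. Then (i) and (ii) hold. (i) Let $\{X_i\}_{i=0}^d$ denote one of the sequences $\{E_i\}_{i=0}^d$, $\{E_{d-i}\}_{i=0}^d$, $\{\tau_i(A)\}_{i=0}^d$, $\{\tau_{d-i}(A)\}_{i=0}^d$, $\{\eta_i(A)\}_{i=0}^d$, $\{\eta_{d-i}(A)\}_{i=0}^d$. Then for $0\le i\le d$, \begin{align*} \frac{1}{\mathrm{tr}(E_dE^*_0)}\sum_{r=0}^d\frac{X_rE^*_0E_d\tau^*_r(A^* )}{\phi_1\phi_2\cdots\phi_r}\cdot\eta_i(A)\xi^*_0 &= X_i\xi^*_0,\\ \frac{\tau^*_d(\theta^*_d)}{\phi}\frac{\langle\xi_d,\xi^*_d\rangle}{\langle\xi_d,\xi^*_0\rangle}\sum_{r=0}^dX_rE^*_d\tau_{d-r}(A)\cdot\eta_i(A)\xi^*_0 &= X_i\xi^*_d,\\ \frac{1}{\mathrm{tr}(E_dE^*_0)}\sum_{r=0}^d\frac{X_{d-r}E^*_0E_d\tau^*_r(A^* )}{\phi_1\phi_2\cdots\phi_r}\cdot\eta_{d-i}(A)\xi^*_0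 &= X_i\xi^*_0,\\ \frac{\tau^*_d(\theta^*_d)}{\phi}\frac{\langle\xi_d,\xi^*_d\rangle}{\langle\xi_d,\xi^*_0\rangle}\sum_{r=0}^dX_{d-r}E^*_d\tau_{d-r}(A)\cdot\eta_{d-i}(A)\xi^*_0 &= X_i\xi^*_d. \end{align*} (ii) Let $\{X_i\}_{i=0}^d$ denote one of the sequences $\{E^*_i\}_{i=0}^d$, $\{E^*_{d-i}\}_{i=0}^d$, $\{\tau^*_i(A^* )\}_{i=0}^d$, $\{\tau^*_{d-i}(A^* )\}_{i=0}^d$, $\{\eta^*_i(A^* )\}_{i=0}^d$, $\{\eta^*_{d-i}(A^* )\}_{i=0}^d$. Then for $0\le i\le d$, \begin{align*} \frac{\tau^*_d(\theta^*_d)}{\varphi}\frac{\langle\xi_0,\xi_0\rangle}{\langle\xi_0,\xi^*_0\rangle}\sum_{r=0}^dX_rE_0E^*_d\tau_{d-r}(A)\cdot\eta_i(A)\xi^*_0 &= X_i\xi_0,\\ \frac{\langle\xi_d,\xi_d\rangle}{\langle\xi_d,\xi^*_0\rangle}\sum_{r=0}^d\frac{X_rE_d\tau^*_r(A^* )}{\phi_1\phi_2\cdots\phi_r}\cdot\eta_i(A)\xi^*_0 &= X_i\xi_d,\\ \frac{\tau^*_d(\theta^*_d)}{\varphi}\frac{\langle\xi_0,\xi_0\rangle}{\langle\xi_0,\xi^*_0\rangle}\sum_{r=0}^dX_{d-r}E_0E^*_d\tau_{d-r}(A)\cdot\eta_{d-i}(A)\xi^*_0 &= X_i\xi_0,\\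 \frac{\langle\xi_d,\xi_d\rangle}{\langle\xi_d,\xi^*_0\rangle}\sum_{r=0}^d\frac{X_{d-r}E_d\tau^*_r(A^* )}{\phi_1\phi_2\cdots\phi_r}\cdot\eta_{d-i}(A)\xi^*_0 &= X_i\xi_d. \end{align*}
   Context: Let $\mathbb{K}$ be a field, $d\ge 0$ an integer, $\mathcal{A}$ a $\mathbb{K}$-algebra isomorphic to the algebra $\mathrm{Mat}_{d+1}(\mathbb{K})$ of all $(d+1)\times(d+1)$ matrices over $\mathbb{K}$, $I$ its identity, and $V$ an irreducible left $\mathcal{A}$-module (so $\dim V=d+1$). For $X\in\mathcal{A}$, $\mathrm{tr}(X)$ is the trace of $X$ (equivalently of its action on $V$). Leonard system. An element of $\mathcal{A}$ is multiplicity-free if it has $d+1$ mutually distinct eigenvalues in $\mathbb{K}$. If $A$ is multiplicity-free with eigenvalues $\theta_0,\dots,\theta_d$, the primitive idempotent of $A$ associated with $\theta_i$ is $E_i=\prod_{0\le j\le d,\,j\ne i}\frac{A-\theta_jI}{\theta_i-\theta_j}$ (the projection onto the one-dimensional $\theta_i$-eigenspace $E_iV$). A Leonard system in $\mathcal{A}$ is a sequence $\Phi=(A;\{E_i\}_{i=0}^d;A^*;\{E^*_i\}_{i=0}^d)$ such that: (i) each of $A,A^*$ is a multiplicity-free element of $\mathcal{A}$ ($A^*$ is just another element; no adjoint is meant); (ii) $\{E_i\}_{i=0}^d$ is an ordering of the primitive idempotents of $A$; (iii) $\{E^*_i\}_{i=0}^d$ is an ordering of the primitive idempotents of $A^*$;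 (iv) for $0\le i,j\le d$, $E_iA^*E_j=0$ if $|i-j|>1$ and $E_iA^*E_j\ne0$ if $|i-j|=1$; (v) for $0\le i,j\le d$, $E^*_iAE^*_j=0$ if $|i-j|>1$ and $E^*_iAE^*_j\neq0$ if $|i-j|=1$. Parameter array. $\theta_i$ (resp. $\theta^*_i$) is the eigenvalue of $A$ (resp. $A^*$) associated with $E_i$ (resp. $E^*_i$). For $0\le i\le d$ define polynomials $\tau_i=(\lambda-\theta_0)(\lambda-\theta_1)\cdots(\lambda-\theta_{i-1})$, $\eta_i=(\lambda-\theta_d)(\lambda-\theta_{d-1})\cdots(\lambda-\theta_{d-i+1})$, $\tau^*_i=(\lambda-\theta^*_0)(\lambda-\theta^*_1)\cdots(\lambda-\theta^*_{i-1})$, $\eta^*_i=(\lambda-\theta^*_d)(\lambda-\theta^*_{d-1})\cdots(\lambda-\theta^*_{d-i+1})$. For $1\le i\le d$ define $\varphi_i=(\theta^*_0-\theta^*_i)\frac{\mathrm{tr}(\tau_i(A)E^*_0)}{\mathrm{tr}(\tau_{i-1}(A)E^*_0)}$ and $\phi_i=(\theta^*_0-\theta^*_i)\frac{\mathrm{tr}(\eta_i(A)E^*_0)}{\mathrm{tr}(\eta_{i-1}(A)E^*_0)}$; the denominators, and all $\varphi_i,\phi_i$, are known to be nonzero. The parameter array of $\Phi$ is $(\{\theta_i\}_{i=0}^d;\{\theta^*_i\}_{i=0}^d;\{\varphi_i\}_{i=1}^d;\{\phi_i\}_{i=1}^d)$. Abbreviate $\varphi=\varphi_1\varphi_2\cdots\varphi_d$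 and $\phi=\phi_1\phi_2\cdots\phi_d$. Empty products are $1$. Bilinear form. There is a unique antiautomorphism $\dagger$ of $\mathcal{A}$ ($\mathbb{K}$-linear bijection with $(XY)^\dagger=Y^\dagger X^\dagger$) with $A^\dagger=A$ and $A^{*\dagger}=A^*$. $\langle\,,\rangle$ denotes a fixed nonzero bilinear form on $V$ with $\langle Xu,v\rangle=\langle u,X^\dagger v\rangle$ for all $X\in\mathcal{A}$, $u,v\in V$; it exists, is unique up to a nonzero scalar factor, and is nondegenerate and symmetric. All scalars appearing in denominators (traces and inner products) are known to be nonzero. The notation $T\cdot v$ means the element $T\in\mathcal{A}$ (including the scalar prefactor and the whole sum) applied to $v\in V$. *)

theory Defs
  imports "Jordan_Normal_Form.Char_Poly"
begin

text \<open>
  A \<open>\<K>\<close>-algebra (a type of class \<open>ring_1\<close> with a scalar multiplication over the field \<open>'k\<close>)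
  together with an algebra isomorphism \<open>\<psi>\<close> onto the full algebra of \<open>(d+1) \<times> (d+1)\<close> matrices.
  The isomorphism is arbitrary; it serves to speak of traces and eigenvalues of elements,
  which do not depend on its choice.
\<close>

locale matrix_algebra = vector_space scale
  for scale :: "'k::field \<Rightarrow> 'a::ring_1 \<Rightarrow> 'a" (infixr "*\<^sub>A" 75) +
  fixes d :: nat
    and \<psi> :: "'a \<Rightarrow> 'k mat"
  assumes scale_mult_left: "(c *\<^sub>A X) * Y = c *\<^sub>A (X * Y)"
    and scale_mult_right: "X * (c *\<^sub>A Y) = c *\<^sub>A (X * Y)"
    and iso_bij: "bij_betw \<psi> UNIV (carrier_mat (Suc d) (Suc d))"
    and iso_one: "\<psi> 1 = 1\<^sub>m (Suc d)"
    and iso_add: "\<psi> (X + Y) = \<psi> X + \<psi> Y"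
    and iso_mult: "\<psi> (X * Y) = \<psi> X * \<psi> Y"
    and iso_scale: "\<psi> (c *\<^sub>A X) = c \<cdot>\<^sub>m \<psi> X"

definition alg_trace :: "('a \<Rightarrow> 'k::field mat) \<Rightarrow> 'a \<Rightarrow> 'k" where
  "alg_trace \<psi> X = (\<Sum>i<dim_row (\<psi> X). \<psi> X $$ (i, i))"

definition eigenvalues :: "('a \<Rightarrow> 'k::field mat) \<Rightarrow> 'a \<Rightarrow> 'k set" where
  "eigenvalues \<psi> X = {\<theta>. eigenvalue (\<psi> X) \<theta>}"

definition alg_eval :: "('k::field \<Rightarrow> 'a::ring_1 \<Rightarrow> 'a) \<Rightarrow> 'k poly \<Rightarrow> 'a \<Rightarrow> 'a" where
  "alg_eval scale p X = (\<Sum>i\<le>degree p. scale (coeff p i) (X ^ i))"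

text \<open>
  A left module is unital, and its \<open>\<K>\<close>-vector space structure is the one induced by the algebra,
  that is, \<open>c v = (c 1) v\<close>.
\<close>

locale left_module = matrix_algebra scale d \<psi>
  for scale :: "'k::field \<Rightarrow> 'a::ring_1 \<Rightarrow> 'a" (infixr "*\<^sub>A" 75)
    and d :: nat
    and \<psi> :: "'a \<Rightarrow> 'k mat" +
  fixes scaleV :: "'k \<Rightarrow> 'v::ab_group_add \<Rightarrow> 'v" (infixr "*\<^sub>V" 75)
    and act :: "'a \<Rightarrow> 'v \<Rightarrow> 'v" (infixr "\<rhd>" 70)
  assumes act_linear_left: "Vector_Spaces.linear scale scaleV (\<lambda>X. X \<rhd> v)"
    and act_linear_right: "Vector_Spaces.linear scaleV scaleV (\<lambda>v. X \<rhd> v)"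
    and act_one: "1 \<rhd> v = v"
    and act_mult: "(X * Y) \<rhd> v = X \<rhd> (Y \<rhd> v)"

definition submodule :: "('a \<Rightarrow> 'v::ab_group_add \<Rightarrow> 'v) \<Rightarrow> 'v set \<Rightarrow> bool" where
  "submodule act W \<longleftrightarrow>
     0 \<in> W \<and> (\<forall>u\<in>W. \<forall>v\<in>W. u + v \<in> W) \<and> (\<forall>X. \<forall>v\<in>W. act X v \<in> W)"

locale irreducible_left_module = left_module scale d \<psi> scaleV act
  for scale :: "'k::field \<Rightarrow> 'a::ring_1 \<Rightarrow> 'a" (infixr "*\<^sub>A" 75)
    and d :: nat
    and \<psi> :: "'a \<Rightarrow> 'k mat"
    and scaleV :: "'k \<Rightarrow> 'v::ab_group_add \<Rightarrow> 'v" (infixr "*\<^sub>V" 75)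
    and act :: "'a \<Rightarrow> 'v \<Rightarrow> 'v" (infixr "\<rhd>" 70) +
  assumes nonzero: "\<exists>v::'v. v \<noteq> 0"
    and irreducible: "submodule act W \<Longrightarrow> W = {0} \<or> W = UNIV"

definition multiplicity_free :: "nat \<Rightarrow> ('a \<Rightarrow> 'k::field mat) \<Rightarrow> 'a \<Rightarrow> bool" where
  "multiplicity_free d \<psi> X \<longleftrightarrow> card (eigenvalues \<psi> X) = Suc d"

text \<open>The factors commute, so the order in which they are multiplied is immaterial.\<close>

definition primitive_idempotent ::
  "('k::field \<Rightarrow> 'a::ring_1 \<Rightarrow> 'a) \<Rightarrow> nat \<Rightarrow> (nat \<Rightarrow> 'k) \<Rightarrow> 'a \<Rightarrow> nat \<Rightarrow> 'a" where
  "primitive_idempotent scale d \<theta> X i =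
     prod_list (map (\<lambda>j. scale (1 / (\<theta> i - \<theta> j)) (X - scale (\<theta> j) 1))
       (filter (\<lambda>j. j \<noteq> i) [0..<Suc d]))"

text \<open>
  \<open>\<theta>\<^sub>0, \<dots>, \<theta>\<^sub>d\<close> is an ordering of the eigenvalues of \<open>X\<close>, and \<open>E\<^sub>i\<close> is the primitive idempotent
  of \<open>X\<close> associated with \<open>\<theta>\<^sub>i\<close>. Sequences are functions on \<open>nat\<close>; values at indices beyond \<open>d\<close>
  are irrelevant.
\<close>

definition eigenvalue_sequence ::
  "('k::field \<Rightarrow> 'a::ring_1 \<Rightarrow> 'a) \<Rightarrow> nat \<Rightarrow> ('a \<Rightarrow> 'k mat) \<Rightarrow> 'a \<Rightarrow> (nat \<Rightarrow> 'a) \<Rightarrow> (nat \<Rightarrow> 'k) \<Rightarrow> bool"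
  where
  "eigenvalue_sequence scale d \<psi> X E \<theta> \<longleftrightarrow>
     bij_betw \<theta> {..d} (eigenvalues \<psi> X) \<and>
     (\<forall>i\<le>d. E i = primitive_idempotent scale d \<theta> X i)"

locale leonard_system = matrix_algebra scale d \<psi>
  for scale :: "'k::field \<Rightarrow> 'a::ring_1 \<Rightarrow> 'a" (infixr "*\<^sub>A" 75)
    and d :: nat
    and \<psi> :: "'a \<Rightarrow> 'k mat" +
  fixes A :: 'a and E :: "nat \<Rightarrow> 'a" and As :: 'a and Es :: "nat \<Rightarrow> 'a"
  assumes multiplicity_free: "multiplicity_free d \<psi> A" "multiplicity_free d \<psi> As"
    and idempotents: "\<exists>\<theta>. eigenvalue_sequence scale d \<psi> A E \<theta>"
    and dual_idempotents: "\<exists>\<theta>. eigenvalue_sequence scale d \<psi> As Es \<theta>"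
    and tridiagonal_zero:
      "\<lbrakk>i \<le> d; j \<le> d; \<bar>int i - int j\<bar> > 1\<rbrakk> \<Longrightarrow> E i * As * E j = 0"
    and tridiagonal_nonzero:
      "\<lbrakk>i \<le> d; j \<le> d; \<bar>int i - int j\<bar> = 1\<rbrakk> \<Longrightarrow> E i * As * E j \<noteq> 0"
    and dual_tridiagonal_zero:
      "\<lbrakk>i \<le> d; j \<le> d; \<bar>int i - int j\<bar> > 1\<rbrakk> \<Longrightarrow> Es i * A * Es j = 0"
    and dual_tridiagonal_nonzero:
      "\<lbrakk>i \<le> d; j \<le> d; \<bar>int i - int j\<bar> = 1\<rbrakk> \<Longrightarrow> Es i * A * Es j \<noteq> 0"

text \<open>
  The polynomials \<open>\<tau>\<^sub>i\<close> and \<open>\<eta>\<^sub>i\<close> for \<open>i \<le> d\<close>; applied to the dual eigenvalue sequence they are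
  \<open>\<tau>\<^sup>*\<^sub>i\<close> and \<open>\<eta>\<^sup>*\<^sub>i\<close>.
\<close>

definition tau_poly :: "(nat \<Rightarrow> 'k::field) \<Rightarrow> nat \<Rightarrow> 'k poly" where
  "tau_poly \<theta> i = (\<Prod>j<i. [:- \<theta> j, 1:])"

definition eta_poly :: "nat \<Rightarrow> (nat \<Rightarrow> 'k::field) \<Rightarrow> nat \<Rightarrow> 'k poly" where
  "eta_poly d \<theta> i = (\<Prod>j<i. [:- \<theta> (d - j), 1:])"

text \<open>\<open>vphi\<close> is the first split sequence and \<open>phi\<close> the second split sequence.\<close>

definition parameter_array ::
  "('k::field \<Rightarrow> 'a::ring_1 \<Rightarrow> 'a) \<Rightarrow> nat \<Rightarrow> ('a \<Rightarrow> 'k mat) \<Rightarrow>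
   'a \<Rightarrow> (nat \<Rightarrow> 'a) \<Rightarrow> 'a \<Rightarrow> (nat \<Rightarrow> 'a) \<Rightarrow>
   (nat \<Rightarrow> 'k) \<Rightarrow> (nat \<Rightarrow> 'k) \<Rightarrow> (nat \<Rightarrow> 'k) \<Rightarrow> (nat \<Rightarrow> 'k) \<Rightarrow> bool" where
  "parameter_array scale d \<psi> A E As Es \<theta> \<theta>s vphi phi \<longleftrightarrow>
     eigenvalue_sequence scale d \<psi> A E \<theta> \<and>
     eigenvalue_sequence scale d \<psi> As Es \<theta>s \<and>
     (\<forall>i\<in>{1..d}. vphi i = (\<theta>s 0 - \<theta>s i) *
        (alg_trace \<psi> (alg_eval scale (tau_poly \<theta> i) A * Es 0) /
         alg_trace \<psi> (alg_eval scale (tau_poly \<theta> (i - 1)) A * Es 0))) \<and>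
     (\<forall>i\<in>{1..d}. phi i = (\<theta>s 0 - \<theta>s i) *
        (alg_trace \<psi> (alg_eval scale (eta_poly d \<theta> i) A * Es 0) /
         alg_trace \<psi> (alg_eval scale (eta_poly d \<theta> (i - 1)) A * Es 0)))"

definition antiautomorphism ::
  "('k::field \<Rightarrow> 'a::ring_1 \<Rightarrow> 'a) \<Rightarrow> ('a \<Rightarrow> 'a) \<Rightarrow> bool" where
  "antiautomorphism scale \<sigma> \<longleftrightarrow>
     Vector_Spaces.linear scale scale \<sigma> \<and> bij \<sigma> \<and> (\<forall>X Y. \<sigma> (X * Y) = \<sigma> Y * \<sigma> X)"

definition bilinear_form ::
  "('k::field \<Rightarrow> 'v::ab_group_add \<Rightarrow> 'v) \<Rightarrow> ('v \<Rightarrow> 'v \<Rightarrow> 'k) \<Rightarrow> bool" where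
  "bilinear_form scaleV B \<longleftrightarrow>
     (\<forall>v. Vector_Spaces.linear scaleV (*) (\<lambda>u. B u v)) \<and>
     (\<forall>u. Vector_Spaces.linear scaleV (*) (\<lambda>v. B u v))"

end

theory Submission
  imports Defs
begin

text \<open>
  Each of the eight identities expresses a selection: among the operators
  \<open>X\<^sub>r M\<^sub>r\<close> in the sum, only the one with \<open>r = i\<close> survives on \<open>\<eta>\<^sub>i(A) \<xi>\<^sup>*\<^sub>0\<close>, and \<open>M\<^sub>i\<close> sends this
  vector to a known multiple of the vector on the right. The third and the fourth identity of each
  part follow from the other two on replacing \<open>X\<^sub>r\<close> by \<open>X\<^sub>d\<^sub>-\<^sub>r\<close> and \<open>i\<close> by \<open>d - i\<close>. Put
  \<open>u\<^sub>i = \<eta>\<^sub>i(A) \<xi>\<^sup>*\<^sub>0\<close>. Two facts about these vectors give everything.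

  First, \<open>E\<^sub>d \<tau>\<^sup>*\<^sub>r(A\<^sup>*) u\<^sub>i\<close> equals \<open>\<phi>\<^sub>1 \<cdots> \<phi>\<^sub>r E\<^sub>d \<xi>\<^sup>*\<^sub>0\<close> for \<open>i = r\<close> and vanishes otherwise
  (\<open>split_product\<close>). As \<open>A\<close> moves the dual eigenspaces by at most one step, \<open>u\<^sub>i\<close> lies in
  \<open>E\<^sup>*\<^sub>0V + \<dots> + E\<^sup>*\<^sub>iV\<close>, which \<open>\<tau>\<^sup>*\<^sub>r(A\<^sup>*)\<close> kills if \<open>i < r\<close>; and \<open>u\<^sub>i\<close> lies in
  \<open>E\<^sub>0V + \<dots> + E\<^sub>d\<^sub>-\<^sub>iV\<close>, from where a polynomial of degree \<open>r < i\<close> in \<open>A\<^sup>*\<close> does not reach \<open>E\<^sub>dV\<close>.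
  If \<open>i = r\<close>, only the leading coefficient of the polynomial in \<open>A\<^sup>*\<close> matters, so
  \<open>\<tau>\<^sup>*\<^sub>r\<close> may be replaced by \<open>(\<lambda> - \<theta>\<^sup>*\<^sub>1) \<cdots> (\<lambda> - \<theta>\<^sup>*\<^sub>r)\<close>. That polynomial in \<open>A\<^sup>*\<close> projects \<open>u\<^sub>r\<close>
  to \<open>E\<^sup>*\<^sub>0V\<close>, with the result \<open>\<Prod>\<^sub>k(\<theta>\<^sup>*\<^sub>0 - \<theta>\<^sup>*\<^sub>k) tr(\<eta>\<^sub>r(A) E\<^sup>*\<^sub>0) \<xi>\<^sup>*\<^sub>0\<close>, and the product of the
  defining quotients of \<open>\<phi>\<^sub>1, \<dots>, \<phi>\<^sub>r\<close> telescopes to the same scalar. The same leading-term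
  argument shows that the scalar is nonzero.

  Second, \<open>E\<^sup>*\<^sub>d \<tau>\<^sub>d\<^sub>-\<^sub>r(A) u\<^sub>i\<close> vanishes for \<open>i \<noteq> r\<close> and is independent of \<open>i\<close> for \<open>i = r\<close>
  (\<open>top_tau_eta\<close>): the polynomial \<open>\<tau>\<^sub>d\<^sub>-\<^sub>r \<eta>\<^sub>i\<close> has degree below \<open>d\<close>, or all the eigenvalues of \<open>A\<close> as
  roots, or is monic of degree \<open>d\<close>. The constant vector is found by taking \<open>i = r = d\<close> in the first
  fact, since \<open>\<tau>\<^sup>*\<^sub>d(A\<^sup>*)\<close> is a multiple of \<open>E\<^sup>*\<^sub>d\<close> (\<open>split_product_top\<close>).

  Reversing the order of the \<open>E\<^sub>i\<close> exchanges \<open>\<tau>\<close> with \<open>\<eta>\<close> and \<open>\<phi>\<close> with \<open>\<varphi>\<close>, so the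
  statements on \<open>\<varphi>\<close> need no separate proof (\<open>reverse\<close>). The bilinear form
  serves only to write the projection of a vector to the line \<open>E\<^sub>iV\<close>, for which the eigenspaces have
  to be orthogonal and anisotropic (\<open>component_eq_form\<close>).
\<close>

section \<open>Idempotents of a multiplicity-free element\<close>

context matrix_algebra
begin

lemma iso_carrier [simp]: "\<psi> X \<in> carrier_mat (Suc d) (Suc d)"
  using iso_bij by (auto simp: bij_betw_def)

lemma iso_dim [simp]: "dim_row (\<psi> X) = Suc d" "dim_col (\<psi> X) = Suc d"
  using iso_carrier[of X] by (simp_all del: iso_carrier)

lemma iso_eqI: "\<psi> X = \<psi> Y \<Longrightarrow> X = Y"
  using iso_bij by (auto simp: bij_betw_def dest: injD)

lemma iso_surj:
  assumes "M \<in> carrier_mat (Suc d) (Suc d)"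
  obtains X where "\<psi> X = M"
  using iso_bij assms by (metis bij_betw_imp_surj_on imageE)

lemma iso_zero: "\<psi> 0 = 0\<^sub>m (Suc d) (Suc d)"
proof -
  have "\<psi> 0 = 0 \<cdot>\<^sub>m \<psi> 0"
    using iso_scale[of 0 0] by simp
  then show ?thesis
    using smult_zero_mat by (metis (no_types, lifting) eq_matI index_smult_mat(1) index_zero_mat iso_dim mult_zero_left)
qed

lemma iso_sum_index:
  "a \<le> d \<Longrightarrow> b \<le> d \<Longrightarrow> \<psi> (\<Sum>i\<in>S. X i) $$ (a, b) = (\<Sum>i\<in>S. \<psi> (X i) $$ (a, b))"
  by (induction S rule: infinite_finite_induct) (auto simp: iso_zero iso_add)

lemma iso_mult_index:
  "a \<le> d \<Longrightarrow> b \<le> d \<Longrightarrow> \<psi> (X * Y) $$ (a, b) = (\<Sum>k\<le>d. \<psi> X $$ (a, k) * \<psi> Y $$ (k, b))"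
  by (simp add: iso_mult scalar_prod_def atLeast0LessThan lessThan_Suc_atMost)

lemma alg_trace_eq: "alg_trace \<psi> X = (\<Sum>i\<le>d. \<psi> X $$ (i, i))"
  by (simp add: alg_trace_def lessThan_Suc_atMost)

lemma alg_trace_mult_commute: "alg_trace \<psi> (X * Y) = alg_trace \<psi> (Y * X)"
proof -
  have "alg_trace \<psi> (X * Y) = (\<Sum>a\<le>d. \<Sum>k\<le>d. \<psi> X $$ (a, k) * \<psi> Y $$ (k, a))"
    by (simp add: alg_trace_eq iso_mult_index)
  also have "\<dots> = (\<Sum>k\<le>d. \<Sum>a\<le>d. \<psi> X $$ (a, k) * \<psi> Y $$ (k, a))"
    by (rule sum.swap)
  also have "\<dots> = alg_trace \<psi> (Y * X)"
    by (simp add: alg_trace_eq iso_mult_index mult.commute)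
  finally show ?thesis .
qed

lemma alg_trace_nondegenerate:
  assumes "X \<noteq> 0"
  shows "\<exists>Y. alg_trace \<psi> (Y * X) \<noteq> 0"
proof -
  have "\<psi> X \<noteq> \<psi> 0"
    using assms iso_eqI by blast
  then obtain a b where ab: "a \<le> d" "b \<le> d" "\<psi> X $$ (a, b) \<noteq> 0"
    by (force simp: iso_zero less_Suc_eq_le intro: eq_matI)
  obtain Y where Y: "\<psi> Y = mat (Suc d) (Suc d) (\<lambda>(i, j). if i = b \<and> j = a then 1 else 0)"
    by (rule iso_surj[of "mat (Suc d) (Suc d) (\<lambda>(i, j). if i = b \<and> j = a then 1 else 0)"]) auto
  have "\<psi> (Y * X) $$ (i, i) = (if i = b then \<psi> X $$ (a, b) else 0)" if "i \<le> d" for i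
    using that ab by (simp add: iso_mult_index Y sum.delta if_distrib[of "\<lambda>x. x * _"] cong: if_cong)
  then have "alg_trace \<psi> (Y * X) = \<psi> X $$ (a, b)"
    using ab by (simp add: alg_trace_eq)
  with ab(3) show ?thesis
    by (intro exI[of _ Y]) simp
qed

text \<open>
  The diagonal matrix units, pulled back to the algebra. The idempotents of any multiplicity-free
  element are conjugate to them, so their properties carry over.
\<close>
lemma diagonal_units:
  obtains D where "\<And>i j. i \<le> d \<Longrightarrow> j \<le> d \<Longrightarrow> D i * D j = (if i = j then D i else 0)"
    and "(\<Sum>i\<le>d. D i) = 1"
    and "\<And>i X. i \<le> d \<Longrightarrow> D i * X * D i = \<psi> X $$ (i, i) *\<^sub>A D i"
    and "\<And>i X. i \<le> d \<Longrightarrow> alg_trace \<psi> (X * D i) = \<psi> X $$ (i, i)"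
    and "\<And>i X a b. a \<le> d \<Longrightarrow> b \<le> d \<Longrightarrow> \<psi> (X * D i) $$ (a, b) = (if b = i then \<psi> X $$ (a, i) else 0)"
proof -
  define M :: "nat \<Rightarrow> 'k mat" where "M i = mat (Suc d) (Suc d) (\<lambda>(a, b). if a = i \<and> b = i then 1 else 0)" for i
  have "\<exists>X. \<psi> X = M i" for i
    using iso_surj[of "M i"] by (auto simp: M_def)
  then obtain D where D: "\<psi> (D i) = M i" for i
    by metis
  have right: "\<psi> (X * D i) $$ (a, b) = (if b = i then \<psi> X $$ (a, i) else 0)" if "a \<le> d" "b \<le> d" for i X a b
    using that by (simp add: iso_mult_index D M_def sum.delta if_distrib[of "\<lambda>x. _ * x"] cong: if_cong)
  have left: "\<psi> (D i * X) $$ (a, b) = (if a = i then \<psi> X $$ (i, b) else 0)" if "a \<le> d" "b \<le> d" for i X a b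
    using that by (simp add: iso_mult_index D M_def sum.delta if_distrib[of "\<lambda>x. x * _"] cong: if_cong)
  show thesis
  proof
    fix i j assume "i \<le> d" "j \<le> d"
    show "D i * D j = (if i = j then D i else 0)"
      by (intro iso_eqI eq_matI) (auto simp: iso_zero less_Suc_eq_le left D M_def)
  next
    show "(\<Sum>i\<le>d. D i) = 1"
      by (intro iso_eqI eq_matI)
        (auto simp: iso_sum_index iso_one less_Suc_eq_le D M_def intro!: sum.neutral)
  next
    fix i X assume "i \<le> d"
    then show "D i * X * D i = \<psi> X $$ (i, i) *\<^sub>A D i"
      by (intro iso_eqI eq_matI) (auto simp: iso_scale less_Suc_eq_le left right D M_def)
  next
    fix i X assume "i \<le> d"
    then show "alg_trace \<psi> (X * D i) = \<psi> X $$ (i, i)"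
      by (simp add: alg_trace_eq right)
  qed (use right in blast)
qed

end

text \<open>
  What the proof uses of a multiplicity-free element and its primitive idempotents. The law
  \<open>compress\<close> is how the rank one of each \<open>F i\<close> enters.
\<close>
locale idempotent_resolution = matrix_algebra scale d \<psi>
  for scale :: "'k::field \<Rightarrow> 'a::ring_1 \<Rightarrow> 'a" (infixr "*\<^sub>A" 75)
    and d :: nat
    and \<psi> :: "'a \<Rightarrow> 'k mat" +
  fixes T :: 'a and F :: "nat \<Rightarrow> 'a" and t :: "nat \<Rightarrow> 'k"
  assumes inj: "inj_on t {..d}"
    and orthogonal: "i \<le> d \<Longrightarrow> j \<le> d \<Longrightarrow> F i * F j = (if i = j then F i else 0)"
    and sum_idempotents: "(\<Sum>i\<le>d. F i) = 1"
    and spectral: "T = (\<Sum>i\<le>d. t i *\<^sub>A F i)"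
    and compress: "i \<le> d \<Longrightarrow> F i * X * F i = alg_trace \<psi> (X * F i) *\<^sub>A F i"
    and idempotent_nonzero: "i \<le> d \<Longrightarrow> F i \<noteq> 0"

text \<open>
  Take the matrix \<open>P\<close> whose columns are eigenvectors of \<open>T\<close>. By the product formula, \<open>F j\<close> fixes
  column \<open>j\<close> and kills the others, that is, \<open>F j P = P D\<^sub>j\<close> with \<open>D\<^sub>j\<close> a diagonal matrix unit. This
  makes \<open>P\<close> injective, hence invertible, and conjugation by \<open>P\<close> reduces all the claims to the
  matrix units.
\<close>
theorem (in matrix_algebra) eigenvalue_sequence_resolution:
  assumes seq: "eigenvalue_sequence scale d \<psi> T F t"
  shows "idempotent_resolution scale d \<psi> T F t"
proof -
  have inj: "inj_on t {..d}" and ev: "\<And>i. i \<le> d \<Longrightarrow> eigenvalue (\<psi> T) (t i)"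
    and F: "\<And>i. i \<le> d \<Longrightarrow> F i = primitive_idempotent scale d t T i"
    using seq by (auto simp: eigenvalue_sequence_def bij_betw_def eigenvalues_def)
  have "\<forall>i. \<exists>w. i \<le> d \<longrightarrow> eigenvector (\<psi> T) w (t i)"
    using ev by (auto simp: eigenvalue_def)
  then obtain w where w: "\<And>i. i \<le> d \<Longrightarrow> eigenvector (\<psi> T) (w i) (t i)"
    by metis
  have w_carrier: "w i \<in> carrier_vec (Suc d)" and w_nz: "w i \<noteq> 0\<^sub>v (Suc d)"
    and w_eq: "\<psi> T *\<^sub>v w i = t i \<cdot>\<^sub>v w i" if "i \<le> d" for i
    using w[OF that] by (auto simp: eigenvector_def)
  obtain P where P: "\<psi> P = mat (Suc d) (Suc d) (\<lambda>(a, i). w i $ a)"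
    by (rule iso_surj[of "mat (Suc d) (Suc d) (\<lambda>(a, i). w i $ a)"]) auto
  obtain D where D_mult: "\<And>i j. i \<le> d \<Longrightarrow> j \<le> d \<Longrightarrow> D i * D j = (if i = j then D i else 0)"
    and D_sum: "(\<Sum>i\<le>d. D i) = 1"
    and D_compress: "\<And>i X. i \<le> d \<Longrightarrow> D i * X * D i = \<psi> X $$ (i, i) *\<^sub>A D i"
    and D_trace: "\<And>i X. i \<le> d \<Longrightarrow> alg_trace \<psi> (X * D i) = \<psi> X $$ (i, i)"
    and D_col: "\<And>i X a b. a \<le> d \<Longrightarrow> b \<le> d \<Longrightarrow>
      \<psi> (X * D i) $$ (a, b) = (if b = i then \<psi> X $$ (a, i) else 0)"
    using diagonal_units by blast
  have TPD: "T * (P * D i) = t i *\<^sub>A (P * D i)" if i: "i \<le> d" for i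
  proof (intro iso_eqI eq_matI)
    fix a b assume "a < dim_row (\<psi> (t i *\<^sub>A (P * D i)))" "b < dim_col (\<psi> (t i *\<^sub>A (P * D i)))"
    then have ab: "a \<le> d" "b \<le> d" by auto
    have "(\<Sum>k\<le>d. \<psi> T $$ (a, k) * w i $ k) = (\<psi> T *\<^sub>v w i) $ a"
      using ab w_carrier[OF i]
      by (simp add: scalar_prod_def atLeast0LessThan lessThan_Suc_atMost)
    also have "\<dots> = t i * w i $ a"
      using ab w_carrier[OF i] by (simp add: w_eq[OF i])
    finally show "\<psi> (T * (P * D i)) $$ (a, b) = \<psi> (t i *\<^sub>A (P * D i)) $$ (a, b)"
      using ab i by (simp add: iso_mult_index[of a b T] iso_scale D_col P)
  qed auto
  have factor: "(c *\<^sub>A (T - s *\<^sub>A 1)) * (P * D i) = (c * (t i - s)) *\<^sub>A (P * D i)" if "i \<le> d" for c s i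
    using TPD[OF that]
    by (simp add: scale_mult_left scale_mult_right left_diff_distrib right_diff_distrib
        scale_left_diff_distrib scale_right_diff_distrib)
  have factors: "prod_list (map (\<lambda>j. c j *\<^sub>A (T - s j *\<^sub>A 1)) js) * (P * D i)
      = prod_list (map (\<lambda>j. c j * (t i - s j)) js) *\<^sub>A (P * D i)" if "i \<le> d" for c s js i
    using factor[OF that]
    by (induction js) (simp_all add: mult.assoc scale_mult_right mult.commute)
  have FPD: "F j * (P * D i) = (if i = j then P * D i else 0)" if ij: "i \<le> d" "j \<le> d" for i j
  proof -
    let ?js = "filter (\<lambda>k. k \<noteq> j) [0..<Suc d]"
    have eq: "F j * (P * D i) = prod_list (map (\<lambda>k. 1 / (t j - t k) * (t i - t k)) ?js) *\<^sub>A (P * D i)"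
      unfolding F[OF ij(2)] primitive_idempotent_def by (rule factors[OF ij(1)])
    show ?thesis
    proof (cases "i = j")
      case True
      have "t j - t k \<noteq> 0" if "k \<in> set ?js" for k
        using that ij inj by (auto simp: inj_on_eq_iff simp del: upt_Suc)
      then have "map (\<lambda>k. 1 / (t j - t k) * (t i - t k)) ?js = map (\<lambda>k. 1) ?js"
        using True by (intro map_cong refl) simp
      then show ?thesis
        using True eq by (simp add: map_replicate_const)
    next
      case False
      then have "0 \<in> set (map (\<lambda>k. 1 / (t j - t k) * (t i - t k)) ?js)"
        unfolding set_map using ij by (intro image_eqI[where x = i]) (auto simp del: upt_Suc)
      then have "prod_list (map (\<lambda>k. 1 / (t j - t k) * (t i - t k)) ?js) = 0"
        by (simp only: prod_list_zero_iff)
      then show ?thesis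
        using False eq by simp
    qed
  qed
  have FP: "F j * P = P * D j" if "j \<le> d" for j
  proof -
    have "F j * P = (\<Sum>i\<le>d. F j * (P * D i))"
      using D_sum by (simp flip: sum_distrib_left)
    also have "\<dots> = P * D j"
      using that by (simp add: FPD)
    finally show ?thesis .
  qed
  \<comment> \<open>If \<open>P c = 0\<close>, then \<open>P D\<^sub>i c = F\<^sub>i P c = 0\<close>, which is \<open>c\<^sub>i\<close> times an eigenvector; so \<open>c = 0\<close>.\<close>
  have "det (\<psi> P) \<noteq> 0"
  proof
    assume "det (\<psi> P) = 0"
    then obtain c where c: "c \<in> carrier_vec (Suc d)" "c \<noteq> 0\<^sub>v (Suc d)" "\<psi> P *\<^sub>v c = 0\<^sub>v (Suc d)"
      using det_0_iff_vec_prod_zero_field[OF iso_carrier, of P] by auto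
    have "c $ i = 0" if i: "i \<le> d" for i
    proof -
      have zero: "\<psi> (P * D i) *\<^sub>v c = 0\<^sub>v (Suc d)"
        unfolding FP[OF i, symmetric] iso_mult using c
        by (subst assoc_mult_mat_vec[where n\<^sub>1 = "Suc d" and n\<^sub>2 = "Suc d" and n\<^sub>3 = "Suc d"])
          (auto intro!: eq_vecI)
      obtain a where a: "a \<le> d" "w i $ a \<noteq> 0"
        using w_nz[OF i] w_carrier[OF i]
        by (metis carrier_vecD eq_vecI index_zero_vec less_Suc_eq_le)
      have "0 = (\<psi> (P * D i) *\<^sub>v c) $ a"
        using zero a by simp
      also have "\<dots> = (\<Sum>b\<le>d. \<psi> (P * D i) $$ (a, b) * c $ b)"
        using a c by (simp add: scalar_prod_def atLeast0LessThan lessThan_Suc_atMost)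
      also have "\<dots> = w i $ a * c $ i"
        using a i by (simp add: D_col P if_distrib[of "\<lambda>x. x * _"] cong: if_cong)
      finally show ?thesis using a by simp
    qed
    then show False
      using c by (metis carrier_vecD eq_vecI index_zero_vec less_Suc_eq_le)
  qed
  then obtain N where N: "N \<in> carrier_mat (Suc d) (Suc d)" "\<psi> P * N = 1\<^sub>m (Suc d)"
    using det_non_zero_imp_unit[OF iso_carrier, of P "()"]
    by (auto simp: Units_def ring_mat_def)
  then have "N * \<psi> P = 1\<^sub>m (Suc d)"
    by (intro mat_mult_left_right_inverse[OF iso_carrier])
  moreover obtain Q where "\<psi> Q = N"
    using iso_surj N(1) by blast
  ultimately have PQ: "P * Q = 1" and QP: "Q * P = 1"
    using N by (auto intro: iso_eqI simp: iso_mult iso_one)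
  have QP': "Q * (P * X) = X" for X
    by (simp add: QP flip: mult.assoc)
  have FQ: "F i = P * D i * Q" if "i \<le> d" for i
    using FP[OF that] PQ by (metis mult.assoc mult_1_right)
  show ?thesis
  proof
    show "inj_on t {..d}" by (rule inj)
  next
    fix i j assume ij: "i \<le> d" "j \<le> d"
    have "F i * F j = P * (D i * D j) * Q"
      using ij by (simp add: FQ mult.assoc QP')
    also have "\<dots> = (if i = j then F i else 0)"
      using ij by (simp add: D_mult FQ)
    finally show "F i * F j = (if i = j then F i else 0)" .
  next
    have "(\<Sum>i\<le>d. F i) = P * (\<Sum>i\<le>d. D i) * Q"
      by (simp add: FQ sum_distrib_left sum_distrib_right)
    then show sumF: "(\<Sum>i\<le>d. F i) = 1"
      by (simp add: D_sum PQ)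
    have "T * F i = t i *\<^sub>A F i" if "i \<le> d" for i
      using TPD[OF that] that by (simp add: FQ scale_mult_left flip: mult.assoc)
    then have "T * (\<Sum>i\<le>d. F i) = (\<Sum>i\<le>d. t i *\<^sub>A F i)"
      by (simp add: sum_distrib_left)
    then show "T = (\<Sum>i\<le>d. t i *\<^sub>A F i)"
      by (simp add: sumF)
  next
    fix i X assume i: "i \<le> d"
    have "F i * X * F i = P * (D i * (Q * X * P) * D i) * Q"
      using i by (simp add: FQ mult.assoc)
    also have "\<dots> = \<psi> (Q * X * P) $$ (i, i) *\<^sub>A F i"
      using i by (simp add: D_compress scale_mult_left scale_mult_right FQ)
    also have "\<psi> (Q * X * P) $$ (i, i) = alg_trace \<psi> (Q * (X * (P * D i)))"
      using D_trace[OF i, of "Q * X * P"] by (simp add: mult.assoc)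
    also have "\<dots> = alg_trace \<psi> (X * F i)"
      using alg_trace_mult_commute[of Q "X * (P * D i)"] i by (simp add: FQ mult.assoc)
    finally show "F i * X * F i = alg_trace \<psi> (X * F i) *\<^sub>A F i" .
  next
    fix i assume i: "i \<le> d"
    show "F i \<noteq> 0"
    proof
      assume "F i = 0"
      then have "Q * (F i * P) = 0" by simp
      then have "D i = 0" using i by (simp add: FP QP')
      then have "\<psi> (1 * D i) $$ (i, i) = 0" using i by (simp add: iso_zero)
      then show False using i by (simp only: D_col) (simp add: iso_one)
    qed
  qed
qed

section \<open>The polynomials \<open>\<tau>\<close> and \<open>\<eta>\<close>\<close>

lemma monic_linear_product:
  fixes f :: "'i \<Rightarrow> 'k::field"
  assumes "finite S"
  shows "degree (\<Prod>j\<in>S. [:- f j, 1:]) = card S" "coeff (\<Prod>j\<in>S. [:- f j, 1:]) (card S) = 1"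
proof -
  show deg: "degree (\<Prod>j\<in>S. [:- f j, 1:]) = card S"
    by (subst degree_prod_eq_sum_degree) auto
  have "lead_coeff (\<Prod>j\<in>S. [:- f j, 1:]) = 1"
    by (subst lead_coeff_prod) simp
  then show "coeff (\<Prod>j\<in>S. [:- f j, 1:]) (card S) = 1"
    by (simp add: deg)
qed

lemma tau_poly_monic: "degree (tau_poly f i) = i" "coeff (tau_poly f i) i = 1"
  using monic_linear_product[of "{..<i}" f] by (simp_all add: tau_poly_def)

lemma eta_poly_monic: "degree (eta_poly d f i) = i" "coeff (eta_poly d f i) i = 1"
  using monic_linear_product[of "{..<i}" "\<lambda>j. f (d - j)"] by (simp_all add: eta_poly_def)

lemma poly_linear_product_eq_0_iff:
  fixes f :: "'i \<Rightarrow> 'k::field"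
  assumes "finite S"
  shows "poly (\<Prod>j\<in>S. [:- f j, 1:]) x = 0 \<longleftrightarrow> (\<exists>j\<in>S. x = f j)"
  using assms by (auto simp: poly_prod)

lemma poly_tau_eq_0_iff: "poly (tau_poly f i) x = 0 \<longleftrightarrow> (\<exists>j<i. x = f j)"
  by (auto simp: tau_poly_def poly_linear_product_eq_0_iff)

lemma poly_eta_eq_0_iff: "poly (eta_poly d f i) x = 0 \<longleftrightarrow> (\<exists>j<i. x = f (d - j))"
  by (auto simp: eta_poly_def poly_linear_product_eq_0_iff[of _ "\<lambda>j. f (d - j)"])

lemma eta_poly_reverse: "i \<le> d \<Longrightarrow> eta_poly d (\<lambda>k. f (d - k)) i = tau_poly f i"
  unfolding eta_poly_def tau_poly_def by (intro prod.cong) auto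

section \<open>Functional calculus\<close>

context idempotent_resolution
begin

lemma mult_idempotent: "i \<le> d \<Longrightarrow> (\<Sum>j\<le>d. f j *\<^sub>A F j) * F i = f i *\<^sub>A F i"
  by (simp add: sum_distrib_right scale_mult_left orthogonal if_distrib[of "scale _"] cong: if_cong)

lemma power_spectral: "T ^ n = (\<Sum>i\<le>d. (t i ^ n) *\<^sub>A F i)"
proof (induction n)
  case 0
  then show ?case by (simp add: sum_idempotents)
next
  case (Suc n)
  have "T ^ Suc n = (\<Sum>i\<le>d. (t i ^ n) *\<^sub>A (T * F i))"
    by (simp add: Suc sum_distrib_left scale_mult_right)
  also have "\<dots> = (\<Sum>i\<le>d. (t i ^ Suc n) *\<^sub>A F i)"
    by (intro sum.cong refl) (use mult_idempotent in \<open>simp add: spectral mult.commute\<close>)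
  finally show ?case .
qed

lemma alg_eval_spectral: "alg_eval scale p T = (\<Sum>i\<le>d. poly p (t i) *\<^sub>A F i)"
proof -
  have "alg_eval scale p T = (\<Sum>m\<le>degree p. \<Sum>i\<le>d. (coeff p m * t i ^ m) *\<^sub>A F i)"
    by (simp add: alg_eval_def power_spectral scale_sum_right)
  also have "\<dots> = (\<Sum>i\<le>d. \<Sum>m\<le>degree p. (coeff p m * t i ^ m) *\<^sub>A F i)"
    by (rule sum.swap)
  also have "\<dots> = (\<Sum>i\<le>d. poly p (t i) *\<^sub>A F i)"
    by (simp add: poly_altdef scale_sum_left)
  finally show ?thesis .
qed

lemma alg_eval_idempotent: "i \<le> d \<Longrightarrow> alg_eval scale p T * F i = poly p (t i) *\<^sub>A F i"
  by (simp add: alg_eval_spectral mult_idempotent)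

lemma idempotent_alg_eval: "i \<le> d \<Longrightarrow> F i * alg_eval scale p T = poly p (t i) *\<^sub>A F i"
  by (simp add: alg_eval_spectral sum_distrib_left scale_mult_right orthogonal
      if_distrib[of "scale _"] cong: if_cong)

lemma alg_eval_mult: "alg_eval scale (p * q) T = alg_eval scale p T * alg_eval scale q T"
proof -
  have "alg_eval scale p T * alg_eval scale q T = (\<Sum>i\<le>d. poly q (t i) *\<^sub>A (alg_eval scale p T * F i))"
    by (simp add: alg_eval_spectral[of q] sum_distrib_left scale_mult_right)
  then show ?thesis
    by (simp add: alg_eval_idempotent alg_eval_spectral[of "p * q"] mult.commute)
qed

lemma alg_trace_idempotent: "i \<le> d \<Longrightarrow> alg_trace \<psi> (F i) = 1"
proof -
  assume i: "i \<le> d"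
  then have "alg_trace \<psi> (F i) *\<^sub>A F i = 1 *\<^sub>A F i"
    using compress[OF i, of 1] by (simp add: orthogonal)
  then show ?thesis
    using idempotent_nonzero[OF i] by (simp only: scale_cancel_right) simp
qed

lemma idempotent_resolution_reverse:
  "idempotent_resolution scale d \<psi> T (\<lambda>i. F (d - i)) (\<lambda>i. t (d - i))"
proof
  show "inj_on (\<lambda>i. t (d - i)) {..d}"
    using inj by (intro inj_onI) (metis atMost_iff diff_diff_cancel diff_le_self inj_onD)
  have rev: "(\<Sum>i\<le>d. g (d - i)) = (\<Sum>i\<le>d. g i)" for g :: "nat \<Rightarrow> 'a"
    by (rule sum.reindex_bij_witness[where i = "\<lambda>i. d - i" and j = "\<lambda>i. d - i"]) auto
  show "(\<Sum>i\<le>d. F (d - i)) = 1"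
    using rev[of F] sum_idempotents by simp
  show "T = (\<Sum>i\<le>d. t (d - i) *\<^sub>A F (d - i))"
    using rev[of "\<lambda>i. t i *\<^sub>A F i"] spectral by simp
qed (auto simp: orthogonal compress idempotent_nonzero)

end

section \<open>Eigenspaces in an irreducible module\<close>

sublocale left_module \<subseteq> V: vector_space scaleV
  using act_linear_right[of 1] by (rule Vector_Spaces.linear.axioms(2))

context left_module
begin

lemma act_left_hom: "module_hom scale scaleV (\<lambda>X. X \<rhd> v)"
  using act_linear_left by (rule Vector_Spaces.linear.axioms(3))

lemma act_right_hom: "module_hom scaleV scaleV (\<lambda>v. X \<rhd> v)"
  using act_linear_right by (rule Vector_Spaces.linear.axioms(3))

lemmas act_add_left = module_hom.add[OF act_left_hom]
  and act_scale_left = module_hom.scale[OF act_left_hom]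
  and act_sum_left = module_hom.sum[OF act_left_hom]
  and act_zero_left = module_hom.zero[OF act_left_hom]
  and act_scale_right = module_hom.scale[OF act_right_hom]
  and act_sum_right = module_hom.sum[OF act_right_hom]
  and act_zero_right = module_hom.zero[OF act_right_hom]

lemmas act_simps = act_add_left act_scale_left act_sum_left act_zero_left
  act_scale_right act_sum_right act_zero_right act_one act_mult

lemma alg_eval_act: "alg_eval scale p X \<rhd> v = (\<Sum>m\<le>degree p. coeff p m *\<^sub>V (X ^ m \<rhd> v))"
  by (simp add: alg_eval_def act_simps)

end

lemma (in irreducible_left_module) cyclic:
  assumes "\<xi> \<noteq> 0"
  obtains X where "v = X \<rhd> \<xi>"
proof -
  let ?W = "range (\<lambda>X. X \<rhd> \<xi>)"
  have "submodule act ?W"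
    unfolding submodule_def
  proof (intro conjI ballI allI)
    show "0 \<in> ?W" using act_zero_left[of \<xi>] by (metis rangeI)
    show "u + v \<in> ?W" if "u \<in> ?W" "v \<in> ?W" for u v
      using that by (auto simp flip: act_add_left)
    show "X \<rhd> v \<in> ?W" if "v \<in> ?W" for X v
      using that by (auto simp flip: act_mult)
  qed
  moreover have "\<xi> \<in> ?W"
    using act_one[of \<xi>] by (metis rangeI)
  ultimately have "?W = UNIV"
    using irreducible assms by blast
  then show thesis
    using that by blast
qed

locale module_resolution = irreducible_left_module scale d \<psi> scaleV act +
    idempotent_resolution scale d \<psi> T F t
  for scale :: "'k::field \<Rightarrow> 'a::ring_1 \<Rightarrow> 'a" (infixr "*\<^sub>A" 75)
    and d :: nat
    and \<psi> :: "'a \<Rightarrow> 'k mat"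
    and scaleV :: "'k \<Rightarrow> 'v::ab_group_add \<Rightarrow> 'v" (infixr "*\<^sub>V" 75)
    and act :: "'a \<Rightarrow> 'v \<Rightarrow> 'v" (infixr "\<rhd>" 70)
    and T F t
begin

lemma resolve: "v = (\<Sum>i\<le>d. F i \<rhd> v)"
  using sum_idempotents act_one[of v] by (simp flip: act_sum_left)

lemma resolve_through: "(X * Y) \<rhd> v = (\<Sum>l\<le>d. (X * F l * Y) \<rhd> v)"
proof -
  have "(\<Sum>l\<le>d. X * F l * Y) = X * Y"
    by (simp add: sum_idempotents flip: sum_distrib_left sum_distrib_right)
  then show ?thesis
    by (simp flip: act_sum_left)
qed

lemma idempotent_act: "i \<le> d \<Longrightarrow> j \<le> d \<Longrightarrow> F i \<rhd> (F j \<rhd> v) = (if i = j then F i \<rhd> v else 0)"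
  using orthogonal[of i j] by (simp add: act_zero_left flip: act_mult)

lemma alg_eval_act_spectral: "alg_eval scale p T \<rhd> v = (\<Sum>i\<le>d. poly p (t i) *\<^sub>V (F i \<rhd> v))"
  by (simp add: alg_eval_spectral act_simps)

lemma idempotent_alg_eval_act:
  "i \<le> d \<Longrightarrow> F i \<rhd> (alg_eval scale p T \<rhd> v) = poly p (t i) *\<^sub>V (F i \<rhd> v)"
  by (simp add: idempotent_alg_eval act_scale_left flip: act_mult)

lemma idempotent_range: "i \<le> d \<Longrightarrow> v \<in> range (act (F i)) \<longleftrightarrow> F i \<rhd> v = v"
  by (metis idempotent_act rangeE rangeI)

lemma compress_act:
  assumes "i \<le> d" "F i \<rhd> \<xi> = \<xi>"
  shows "F i \<rhd> (X \<rhd> \<xi>) = alg_trace \<psi> (X * F i) *\<^sub>V \<xi>"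
  using compress[OF assms(1), of X] assms(2) by (metis act_mult act_scale_left)

text \<open>Each \<open>F\<^sub>iV\<close> is a line: by irreducibility every vector is \<open>X \<xi>\<close>, and \<open>F\<^sub>i X F\<^sub>i\<close> is a scalar multiple of \<open>F\<^sub>i\<close>.\<close>
lemma idempotent_line:
  assumes "i \<le> d" "F i \<rhd> \<xi> = \<xi>" "\<xi> \<noteq> 0"
  obtains c where "F i \<rhd> v = c *\<^sub>V \<xi>"
proof -
  obtain X where "v = X \<rhd> \<xi>"
    using cyclic[OF assms(3)] .
  then show thesis
    using that compress_act[OF assms(1,2)] by metis
qed

text \<open>
  This turns the nonvanishing of products such as \<open>E\<^sup>*\<^sub>i A E\<^sup>*\<^sub>j\<close>, a statement in the algebra, into
  nonvanishing on vectors. Nondegeneracy of the trace form gives \<open>Y\<close> with \<open>tr(Y X F\<^sub>i) \<noteq> 0\<close>, and then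
  \<open>F\<^sub>i Y\<close> takes \<open>X F\<^sub>i v\<close> to a nonzero multiple of \<open>F\<^sub>i v\<close>.
\<close>
lemma act_nonzero_on_line:
  assumes i: "i \<le> d" and X: "X * F i \<noteq> 0" and v: "F i \<rhd> v \<noteq> 0"
  shows "(X * F i) \<rhd> v \<noteq> 0"
proof
  assume zero: "(X * F i) \<rhd> v = 0"
  obtain Y where Y: "alg_trace \<psi> (Y * (X * F i)) \<noteq> 0"
    using alg_trace_nondegenerate[OF X] by blast
  have "F i \<rhd> (Y \<rhd> ((X * F i) \<rhd> v)) = (F i * (Y * X) * F i) \<rhd> v"
    by (simp add: act_mult mult.assoc)
  also have "\<dots> = alg_trace \<psi> (Y * (X * F i)) *\<^sub>V (F i \<rhd> v)"
    using compress[OF i, of "Y * X"] by (simp add: mult.assoc flip: act_scale_left)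
  finally show False
    using zero Y v by (simp add: act_zero_right)
qed

end

text \<open>
  An operator \<open>R\<close> that moves the eigenspaces of \<open>T\<close> up by at most one step, and by exactly one step
  where it can. In a Leonard system, \<open>A\<close> acts in this way on the eigenspaces of \<open>A\<^sup>*\<close> and vice versa.
\<close>
locale raising = module_resolution scale d \<psi> scaleV act T F t
  for scale :: "'k::field \<Rightarrow> 'a::ring_1 \<Rightarrow> 'a" (infixr "*\<^sub>A" 75)
    and d :: nat
    and \<psi> :: "'a \<Rightarrow> 'k mat"
    and scaleV :: "'k \<Rightarrow> 'v::ab_group_add \<Rightarrow> 'v" (infixr "*\<^sub>V" 75)
    and act :: "'a \<Rightarrow> 'v \<Rightarrow> 'v" (infixr "\<rhd>" 70)
    and T F t +
  fixes R :: 'a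
  assumes raise_zero: "i \<le> d \<Longrightarrow> Suc j < i \<Longrightarrow> F i * R * F j = 0"
    and raise_nonzero: "Suc j \<le> d \<Longrightarrow> F (Suc j) * R * F j \<noteq> 0"
begin

lemma power_above:
  assumes v: "\<And>k. j < k \<Longrightarrow> k \<le> d \<Longrightarrow> F k \<rhd> v = 0"
  shows "j + n < k \<Longrightarrow> k \<le> d \<Longrightarrow> F k \<rhd> (R ^ n \<rhd> v) = 0"
proof (induction n arbitrary: k)
  case 0
  then show ?case using v by (simp add: act_one)
next
  case (Suc n)
  have "F k \<rhd> (R ^ Suc n \<rhd> v) = (\<Sum>l\<le>d. (F k * R * F l) \<rhd> (R ^ n \<rhd> v))"
    using resolve_through[of "F k * R" 1 "R ^ n \<rhd> v"] by (simp add: act_mult)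
  also have "\<dots> = 0"
  proof (intro sum.neutral ballI)
    fix l assume l: "l \<in> {..d}"
    show "(F k * R * F l) \<rhd> (R ^ n \<rhd> v) = 0"
    proof (cases "j + n < l")
      case True
      then show ?thesis using Suc.IH[of l] l by (simp add: act_mult act_zero_right)
    next
      case False
      then show ?thesis using Suc.prems raise_zero[of k l] by (simp add: act_zero_left)
    qed
  qed
  finally show ?case .
qed

text \<open>
  The component of \<open>R\<^sup>n v\<close> at the highest index that it can reach comes from a single path, along
  which each step is injective.
\<close>
lemma power_top_nonzero:
  assumes v: "\<And>k. j < k \<Longrightarrow> k \<le> d \<Longrightarrow> F k \<rhd> v = 0" and j: "F j \<rhd> v \<noteq> 0"
  shows "j + n \<le> d \<Longrightarrow> F (j + n) \<rhd> (R ^ n \<rhd> v) \<noteq> 0"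
proof (induction n)
  case 0
  then show ?case using j by (simp add: act_one)
next
  case (Suc n)
  let ?u = "R ^ n \<rhd> v" and ?k = "j + n"
  have "F (Suc ?k) \<rhd> (R ^ Suc n \<rhd> v) = (\<Sum>l\<le>d. (F (Suc ?k) * R * F l) \<rhd> ?u)"
    using resolve_through[of "F (Suc ?k) * R" 1 ?u] by (simp add: act_mult)
  also have "\<dots> = (\<Sum>l\<in>{?k}. (F (Suc ?k) * R * F l) \<rhd> ?u)"
  proof (intro sum.mono_neutral_right ballI)
    fix l assume "l \<in> {..d} - {?k}"
    then consider "?k < l" "l \<le> d" | "Suc l < Suc ?k"
      by force
    then show "(F (Suc ?k) * R * F l) \<rhd> ?u = 0"
      using power_above[where j = j and n = n and k = l, OF v] raise_zero[of "Suc ?k" l] Suc.prems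
      by cases (simp_all add: act_simps)
  qed (use Suc.prems in auto)
  also have "\<dots> \<noteq> 0"
    using act_nonzero_on_line[of ?k "F (Suc ?k) * R" ?u] raise_nonzero[of ?k] Suc by simp
  finally show ?case by simp
qed

lemma alg_eval_above:
  assumes v: "\<And>k. j < k \<Longrightarrow> k \<le> d \<Longrightarrow> F k \<rhd> v = 0"
    and "j + degree p < k" "k \<le> d"
  shows "F k \<rhd> (alg_eval scale p R \<rhd> v) = 0"
  using assms(2,3) by (auto simp: alg_eval_act act_simps power_above[OF v] intro!: sum.neutral)

text \<open>At that highest index a monic polynomial of degree \<open>n\<close> in \<open>R\<close> cannot be told from \<open>R\<^sup>n\<close>.\<close>
lemma alg_eval_top:
  assumes v: "\<And>k. j < k \<Longrightarrow> k \<le> d \<Longrightarrow> F k \<rhd> v = 0"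
    and p: "degree p = n" "coeff p n = 1" and "j + n \<le> d"
  shows "F (j + n) \<rhd> (alg_eval scale p R \<rhd> v) = F (j + n) \<rhd> (R ^ n \<rhd> v)"
proof -
  have "F (j + n) \<rhd> (alg_eval scale p R \<rhd> v) = (\<Sum>m\<le>n. coeff p m *\<^sub>V (F (j + n) \<rhd> (R ^ m \<rhd> v)))"
    by (simp add: alg_eval_act act_simps p)
  also have "\<dots> = (\<Sum>m\<in>{n}. coeff p m *\<^sub>V (F (j + n) \<rhd> (R ^ m \<rhd> v)))"
    using assms(4) by (intro sum.mono_neutral_right) (auto simp: power_above[OF v])
  finally show ?thesis by (simp add: p)
qed

end

section \<open>The bilinear form on eigenspaces\<close>

context module_resolution
begin

context
  fixes B :: "'v \<Rightarrow> 'v \<Rightarrow> 'k" and dagger :: "'a \<Rightarrow> 'a"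
  assumes bilinear: "bilinear_form scaleV B" and nonzero_form: "\<exists>u v. B u v \<noteq> 0"
    and adjoint: "\<And>X u v. B (X \<rhd> u) v = B u (dagger X \<rhd> v)"
    and self_adjoint: "dagger T = T"
begin

lemma form_left_hom: "module_hom scaleV (*) (\<lambda>u. B u v)"
  and form_right_hom: "module_hom scaleV (*) (\<lambda>v. B u v)"
  using bilinear unfolding bilinear_form_def by (blast intro: Vector_Spaces.linear.axioms(3))+

lemma form_scale_left: "B (c *\<^sub>V u) v = c * B u v"
  by (rule module_hom.scale[OF form_left_hom])

lemma form_scale_right: "B u (c *\<^sub>V v) = c * B u v"
  by (rule module_hom.scale[OF form_right_hom])

text \<open>The usual argument for a self-adjoint operator: the form has to see both eigenvalues.\<close>
lemma form_orthogonal: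
  assumes ij: "i \<le> d" "j \<le> d" "i \<noteq> j"
  shows "B (F i \<rhd> u) (F j \<rhd> v) = 0"
proof -
  have T: "T \<rhd> (F k \<rhd> x) = t k *\<^sub>V (F k \<rhd> x)" if "k \<le> d" for k x
    using mult_idempotent[OF that, of t] that by (metis act_mult act_scale_left spectral)
  have "t i * B (F i \<rhd> u) (F j \<rhd> v) = B (T \<rhd> (F i \<rhd> u)) (F j \<rhd> v)"
    using ij by (simp add: T form_scale_left)
  also have "\<dots> = t j * B (F i \<rhd> u) (F j \<rhd> v)"
    using ij adjoint[of T "F i \<rhd> u" "F j \<rhd> v"] by (simp add: self_adjoint T form_scale_right)
  finally show ?thesis
    using inj ij by (auto simp: inj_on_eq_iff)
qed

lemma form_component:
  assumes i: "i \<le> d" and u: "F i \<rhd> u = u"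
  shows "B u v = B u (F i \<rhd> v)"
proof -
  have "B u v = (\<Sum>j\<le>d. B u (F j \<rhd> v))"
    using resolve[of v] module_hom.sum[OF form_right_hom] by metis
  also have "\<dots> = (\<Sum>j\<in>{i}. B u (F j \<rhd> v))"
    using i form_orthogonal[of i _ u v] u by (intro sum.mono_neutral_right) auto
  finally show ?thesis by simp
qed

text \<open>The left radical is a submodule, because the algebra acts with adjoints.\<close>
lemma form_nondegenerate:
  assumes "u \<noteq> 0"
  shows "\<exists>v. B u v \<noteq> 0"
proof -
  let ?W = "{u. \<forall>v. B u v = 0}"
  have "submodule act ?W"
    by (auto simp: submodule_def adjoint module_hom.zero[OF form_left_hom] module_hom.add[OF form_left_hom])
  moreover have "?W \<noteq> UNIV"
    using nonzero_form by blast
  ultimately have "?W = {0}"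
    using irreducible by blast
  then show ?thesis
    using assms by blast
qed

text \<open>
  A vector \<open>u\<close> of the line \<open>F\<^sub>iV\<close> is orthogonal to the other eigenspaces; if it were isotropic, it
  would be orthogonal to its own line as well, hence in the radical.
\<close>
lemma form_anisotropic:
  assumes i: "i \<le> d" and u: "F i \<rhd> u = u" "u \<noteq> 0"
  shows "B u u \<noteq> 0"
proof -
  obtain v where v: "B u v \<noteq> 0"
    using form_nondegenerate[OF u(2)] by blast
  obtain c where "F i \<rhd> v = c *\<^sub>V u"
    using idempotent_line[OF i u] .
  then show ?thesis
    using v form_component[OF i u(1), of v] by (auto simp: form_scale_right)
qed

lemma component_eq_form:
  assumes i: "i \<le> d" and u: "F i \<rhd> u = u" "u \<noteq> 0"
  shows "F i \<rhd> v = (B u v / B u u) *\<^sub>V u"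
proof -
  obtain c where c: "F i \<rhd> v = c *\<^sub>V u"
    using idempotent_line[OF i u] .
  then show ?thesis
    using form_component[OF i u(1), of v] form_anisotropic[OF assms] by (simp add: form_scale_right)
qed

end

end

section \<open>The vectors \<open>\<eta>\<^sub>i(A) \<xi>\<^sup>*\<^sub>0\<close>\<close>

text \<open>
  A Leonard system on an irreducible module with a nonzero vector \<open>\<xi>\<close> of \<open>E\<^sup>*\<^sub>0V\<close>. On the dual side only
  the raising action of \<open>A\<close> is recorded, whereas \<open>A\<^sup>*\<close> is required to be tridiagonal in both directions, so
  that the axioms are invariant under reversal of the \<open>E\<^sub>i\<close>.
\<close>
locale leonard_module = irreducible_left_module scale d \<psi> scaleV act +
    eig: raising scale d \<psi> scaleV act A E \<theta> As +
    dual: raising scale d \<psi> scaleV act As Es \<theta>s A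
  for scale :: "'k::field \<Rightarrow> 'a::ring_1 \<Rightarrow> 'a" (infixr "*\<^sub>A" 75)
    and d :: nat
    and \<psi> :: "'a \<Rightarrow> 'k mat"
    and scaleV :: "'k \<Rightarrow> 'v::ab_group_add \<Rightarrow> 'v" (infixr "*\<^sub>V" 75)
    and act :: "'a \<Rightarrow> 'v \<Rightarrow> 'v" (infixr "\<rhd>" 70)
    and A E \<theta> As Es \<theta>s +
  fixes \<xi> :: 'v
  assumes lower_zero: "j \<le> d \<Longrightarrow> Suc i < j \<Longrightarrow> E i * As * E j = 0"
    and lower_nonzero: "Suc i \<le> d \<Longrightarrow> E i * As * E (Suc i) \<noteq> 0"
    and dual_vector: "Es 0 \<rhd> \<xi> = \<xi>" "\<xi> \<noteq> 0"
begin

abbreviation "tr \<equiv> alg_trace \<psi>"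
abbreviation "\<eta> i \<equiv> alg_eval scale (eta_poly d \<theta> i) A"
abbreviation "\<tau> i \<equiv> alg_eval scale (tau_poly \<theta> i) A"
abbreviation "\<tau>s i \<equiv> alg_eval scale (tau_poly \<theta>s i) As"

lemma reverse:
  "leonard_module scale d \<psi> scaleV act A (\<lambda>i. E (d - i)) (\<lambda>i. \<theta> (d - i)) As Es \<theta>s \<xi>"
proof -
  interpret rev: idempotent_resolution scale d \<psi> A "\<lambda>i. E (d - i)" "\<lambda>i. \<theta> (d - i)"
    by (rule eig.idempotent_resolution_reverse)
  show ?thesis
  proof unfold_locales
    fix i j assume "i \<le> d" "Suc j < i"
    then show "E (d - i) * As * E (d - j) = 0"
      using lower_zero[of "d - j" "d - i"] by simp
  next
    fix j assume j: "Suc j \<le> d"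
    then show "E (d - Suc j) * As * E (d - j) \<noteq> 0"
      using lower_nonzero[of "d - Suc j"] by (simp add: Suc_diff_Suc)
  next
    fix i j assume "j \<le> d" "Suc i < j"
    then show "E (d - i) * As * E (d - j) = 0"
      using eig.raise_zero[of "d - i" "d - j"] by simp
  next
    fix i assume "Suc i \<le> d"
    then show "E (d - i) * As * E (d - Suc i) \<noteq> 0"
      using eig.raise_nonzero[of "d - Suc i"] by (simp add: Suc_diff_Suc)
  qed (use dual_vector in auto)
qed

lemma dual_vector_component: "0 < k \<Longrightarrow> k \<le> d \<Longrightarrow> Es k \<rhd> \<xi> = 0"
  using dual.idempotent_act[of k 0 \<xi>] dual_vector by simp

lemma dual_component: "Es 0 \<rhd> (X \<rhd> \<xi>) = tr (X * Es 0) *\<^sub>V \<xi>"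
  by (rule dual.compress_act) (auto simp: dual_vector)

lemma top_component:
  assumes "degree p = d" "coeff p d = 1"
  shows "Es d \<rhd> (alg_eval scale p A \<rhd> \<xi>) = Es d \<rhd> (A ^ d \<rhd> \<xi>)"
  using dual.alg_eval_top[of 0 \<xi> p d] assms dual_vector_component by simp

text \<open>
  If \<open>E\<^sub>j \<xi> = 0\<close>, then the product of the \<open>A - \<theta>\<^sub>k\<close> with \<open>k \<noteq> j\<close>, of degree \<open>d\<close>, kills \<open>\<xi>\<close>; but a monic
  polynomial of degree \<open>d\<close> in \<open>A\<close> carries \<open>\<xi>\<close> to a vector with nonzero component in \<open>E\<^sup>*\<^sub>dV\<close>.
\<close>
lemma eig_component_nonzero:
  assumes j: "j \<le> d"
  shows "E j \<rhd> \<xi> \<noteq> 0"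
proof
  assume zero: "E j \<rhd> \<xi> = 0"
  define p where "p = (\<Prod>k\<in>{..d} - {j}. [:- \<theta> k, 1:])"
  have "card ({..d} - {j}) = d"
    using j by simp
  then have p: "degree p = d" "coeff p d = 1"
    using monic_linear_product[of "{..d} - {j}" \<theta>] by (simp_all add: p_def)
  have "poly p (\<theta> k) *\<^sub>V (E k \<rhd> \<xi>) = 0" if "k \<le> d" for k
    using that zero by (cases "k = j") (auto simp: p_def poly_linear_product_eq_0_iff)
  then have "alg_eval scale p A \<rhd> \<xi> = 0"
    unfolding eig.alg_eval_act_spectral by (intro sum.neutral) blast
  then have "Es d \<rhd> (A ^ d \<rhd> \<xi>) = 0"
    using top_component[OF p] by (simp add: act_zero_right)
  then show False
    using dual.power_top_nonzero[of 0 \<xi> d] dual_vector dual_vector_component by simp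
qed

lemma eta_above: "i \<le> d \<Longrightarrow> d - i < k \<Longrightarrow> k \<le> d \<Longrightarrow> E k \<rhd> (\<eta> i \<rhd> v) = 0"
proof -
  assume "i \<le> d" "d - i < k" "k \<le> d"
  then have "poly (eta_poly d \<theta> i) (\<theta> k) = 0"
    unfolding poly_eta_eq_0_iff by (intro exI[of _ "d - k"]) auto
  then show ?thesis
    using \<open>k \<le> d\<close> by (simp add: eig.idempotent_alg_eval_act)
qed

lemma eta_top_nonzero:
  assumes i: "i \<le> d"
  shows "E (d - i) \<rhd> (\<eta> i \<rhd> \<xi>) \<noteq> 0"
proof -
  have "poly (eta_poly d \<theta> i) (\<theta> (d - i)) \<noteq> 0"
    unfolding poly_eta_eq_0_iff using i eig.inj by (auto simp: inj_on_eq_iff)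
  then show ?thesis
    using eig_component_nonzero[of "d - i"] by (simp add: eig.idempotent_alg_eval_act)
qed

text \<open>
  For \<open>i < r\<close> the vector has no component outside the eigenspaces that \<open>\<tau>\<^sup>*\<^sub>r(A\<^sup>*)\<close> kills; for \<open>i > r\<close> it
  starts below \<open>E\<^sub>d\<^sub>-\<^sub>rV\<close>, too low to be raised to \<open>E\<^sub>dV\<close> in \<open>r\<close> steps.
\<close>
lemma dual_tau_eta_distinct:
  assumes ri: "r \<le> d" "i \<le> d" "i \<noteq> r"
  shows "E d \<rhd> (\<tau>s r \<rhd> (\<eta> i \<rhd> \<xi>)) = 0"
proof (cases "i < r")
  case True
  have "poly (tau_poly \<theta>s r) (\<theta>s k) *\<^sub>V (Es k \<rhd> (\<eta> i \<rhd> \<xi>)) = 0" if "k \<le> d" for k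
  proof (cases "k < r")
    case True
    then show ?thesis by (auto simp: poly_tau_eq_0_iff)
  next
    case False
    then show ?thesis
      using dual.alg_eval_above[of 0 \<xi> "eta_poly d \<theta> i" k] that \<open>i < r\<close> dual_vector_component
      by (simp add: eta_poly_monic)
  qed
  then have "\<tau>s r \<rhd> (\<eta> i \<rhd> \<xi>) = 0"
    unfolding dual.alg_eval_act_spectral by (intro sum.neutral) blast
  then show ?thesis
    by (simp add: act_zero_right)
next
  case False
  then show ?thesis
    using eig.alg_eval_above[of "d - i" "\<eta> i \<rhd> \<xi>" "tau_poly \<theta>s r" d] eta_above[of i] ri
    by (simp add: tau_poly_monic)
qed

text \<open>
  Seen from \<open>E\<^sub>dV\<close>, the polynomial \<open>\<tau>\<^sup>*\<^sub>r\<close> may be exchanged for any monic polynomial of degree \<open>r\<close>.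
  The choice \<open>(\<lambda> - \<theta>\<^sup>*\<^sub>1) \<cdots> (\<lambda> - \<theta>\<^sup>*\<^sub>r)\<close> leaves only the component of \<open>\<eta>\<^sub>r(A) \<xi>\<close> in \<open>E\<^sup>*\<^sub>0V\<close>.
\<close>
lemma dual_tau_eta:
  assumes r: "r \<le> d"
  shows "E d \<rhd> (\<tau>s r \<rhd> (\<eta> r \<rhd> \<xi>)) = ((\<Prod>k=1..r. \<theta>s 0 - \<theta>s k) * tr (\<eta> r * Es 0)) *\<^sub>V (E d \<rhd> \<xi>)"
    and "E d \<rhd> (\<tau>s r \<rhd> (\<eta> r \<rhd> \<xi>)) \<noteq> 0"
proof -
  let ?u = "\<eta> r \<rhd> \<xi>"
  define p where "p = (\<Prod>k=1..r. [:- \<theta>s k, 1:])"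
  have p: "degree p = r" "coeff p r = 1"
    using monic_linear_product[of "{1..r}" \<theta>s] by (simp_all add: p_def)
  have top: "E d \<rhd> (alg_eval scale q As \<rhd> ?u) = E d \<rhd> (As ^ r \<rhd> ?u)"
    if "degree q = r" "coeff q r = 1" for q
    using eig.alg_eval_top[of "d - r" ?u q r] eta_above[of r] that r by simp
  have "alg_eval scale p As \<rhd> ?u = (\<Sum>k\<le>d. poly p (\<theta>s k) *\<^sub>V (Es k \<rhd> ?u))"
    by (rule dual.alg_eval_act_spectral)
  also have "\<dots> = (\<Sum>k\<in>{0}. poly p (\<theta>s k) *\<^sub>V (Es k \<rhd> ?u))"
  proof (intro sum.mono_neutral_right ballI)
    fix k assume k: "k \<in> {..d} - {0}"
    show "poly p (\<theta>s k) *\<^sub>V (Es k \<rhd> ?u) = 0"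
    proof (cases "k \<le> r")
      case True
      then show ?thesis using k by (auto simp: p_def poly_linear_product_eq_0_iff)
    next
      case False
      then show ?thesis
        using dual.alg_eval_above[of 0 \<xi> "eta_poly d \<theta> r" k] k dual_vector_component
        by (simp add: eta_poly_monic)
    qed
  qed auto
  also have "\<dots> = ((\<Prod>k=1..r. \<theta>s 0 - \<theta>s k) * tr (\<eta> r * Es 0)) *\<^sub>V \<xi>"
    by (simp add: dual_component p_def poly_prod)
  finally show "E d \<rhd> (\<tau>s r \<rhd> ?u) = ((\<Prod>k=1..r. \<theta>s 0 - \<theta>s k) * tr (\<eta> r * Es 0)) *\<^sub>V (E d \<rhd> \<xi>)"
    using top[OF p] top[OF tau_poly_monic] by (simp add: act_scale_right)
  show "E d \<rhd> (\<tau>s r \<rhd> ?u) \<noteq> 0"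
    using eig.power_top_nonzero[of "d - r" ?u r] eta_above[of r] eta_top_nonzero[of r] r
      top[OF tau_poly_monic] by simp
qed

lemma trace_eta_nonzero: "r \<le> d \<Longrightarrow> tr (\<eta> r * Es 0) \<noteq> 0"
  using dual_tau_eta[of r] by auto

lemma eta_bottom: "\<eta> d = poly (eta_poly d \<theta> d) (\<theta> 0) *\<^sub>A E 0"
proof -
  have "\<eta> d = (\<Sum>k\<le>d. poly (eta_poly d \<theta> d) (\<theta> k) *\<^sub>A E k)"
    by (rule eig.alg_eval_spectral)
  also have "\<dots> = (\<Sum>k\<in>{0}. poly (eta_poly d \<theta> d) (\<theta> k) *\<^sub>A E k)"
  proof (intro sum.mono_neutral_right ballI)
    fix k assume "k \<in> {..d} - {0}"
    then have "poly (eta_poly d \<theta> d) (\<theta> k) = 0"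
      unfolding poly_eta_eq_0_iff by (intro exI[of _ "d - k"]) auto
    then show "poly (eta_poly d \<theta> d) (\<theta> k) *\<^sub>A E k = 0"
      by simp
  qed auto
  finally show ?thesis by simp
qed

text \<open>Applied to the reversed system, this is the nonvanishing of \<open>tr(E\<^sub>d E\<^sup>*\<^sub>0)\<close>.\<close>
lemma trace_bottom_nonzero: "tr (E 0 * Es 0) \<noteq> 0"
proof
  assume zero: "tr (E 0 * Es 0) = 0"
  have "(\<eta> d * Es 0) = poly (eta_poly d \<theta> d) (\<theta> 0) *\<^sub>A (E 0 * Es 0)"
    by (simp add: eta_bottom scale_mult_left)
  then have "tr (\<eta> d * Es 0) = 0"
    using zero by (simp add: alg_trace_eq iso_scale flip: sum_distrib_left)
  then show False
    using trace_eta_nonzero[of d] by simp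
qed

text \<open>The second split sequence; the first one is that of the reversed system.\<close>
definition split_sequence :: "(nat \<Rightarrow> 'k) \<Rightarrow> bool" where
  "split_sequence phi \<longleftrightarrow> (\<forall>i\<in>{1..d}. phi i = (\<theta>s 0 - \<theta>s i) *
     (tr (\<eta> i * Es 0) / tr (\<eta> (i - 1) * Es 0)))"

text \<open>The quotients of traces telescope, and the trace left in the denominator is \<open>tr(E\<^sup>*\<^sub>0) = 1\<close>.\<close>
lemma split_sequence_prod:
  assumes "split_sequence phi"
  shows "r \<le> d \<Longrightarrow> (\<Prod>k=1..r. phi k) = (\<Prod>k=1..r. \<theta>s 0 - \<theta>s k) * tr (\<eta> r * Es 0)"
proof (induction r)
  case 0
  have "\<eta> 0 = 1"
    by (simp add: alg_eval_def eta_poly_def)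
  then show ?case
    by (simp add: dual.alg_trace_idempotent)
next
  case (Suc r)
  then show ?case
    using assms trace_eta_nonzero[of r] by (simp add: split_sequence_def)
qed

lemma split_product:
  assumes phi: "split_sequence phi" and ri: "r \<le> d" "i \<le> d"
  shows "E d \<rhd> (\<tau>s r \<rhd> (\<eta> i \<rhd> \<xi>)) = (if i = r then (\<Prod>k=1..r. phi k) else 0) *\<^sub>V (E d \<rhd> \<xi>)"
  using dual_tau_eta(1)[OF ri(1)] dual_tau_eta_distinct[OF ri] split_sequence_prod[OF phi ri(1)]
  by auto

lemma split_product_nonzero:
  assumes "split_sequence phi" "r \<le> d"
  shows "(\<Prod>k=1..r. phi k) \<noteq> 0"
  using split_product[OF assms assms(2)] dual_tau_eta(2)[OF assms(2)] by auto

lemma top_tau_eta: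
  assumes ri: "r \<le> d" "i \<le> d"
  shows "Es d \<rhd> (\<tau> (d - r) \<rhd> (\<eta> i \<rhd> \<xi>)) = (if i = r then Es d \<rhd> (A ^ d \<rhd> \<xi>) else 0)"
proof -
  let ?p = "tau_poly \<theta> (d - r) * eta_poly d \<theta> i"
  have nz: "tau_poly \<theta> (d - r) \<noteq> 0" "eta_poly d \<theta> i \<noteq> 0"
    using tau_poly_monic(2)[of \<theta> "d - r"] eta_poly_monic(2)[of d \<theta> i] by auto
  then have deg: "degree ?p = d - r + i"
    by (simp add: degree_mult_eq tau_poly_monic eta_poly_monic)
  have eq: "\<tau> (d - r) \<rhd> (\<eta> i \<rhd> \<xi>) = alg_eval scale ?p A \<rhd> \<xi>"
    by (simp add: eig.alg_eval_mult act_mult)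
  consider "i < r" | "i = r" | "r < i" by linarith
  then show ?thesis
  proof cases
    case 1
    then show ?thesis
      unfolding eq using dual.alg_eval_above[of 0 \<xi> ?p d] dual_vector_component ri
      by (simp add: deg)
  next
    case 2
    then have "degree ?p = d"
      using deg ri by simp
    moreover have "lead_coeff ?p = 1"
      by (simp add: lead_coeff_mult) (simp add: tau_poly_monic eta_poly_monic)
    ultimately show ?thesis
      unfolding eq using 2 top_component[of ?p] by simp
  next
    case 3
    have "poly ?p (\<theta> k) = 0" if "k \<le> d" for k
    proof (cases "k < d - r")
      case True
      then show ?thesis by (auto simp: poly_tau_eq_0_iff)
    next
      case False
      then have "\<exists>j<i. \<theta> k = \<theta> (d - j)"
        using 3 that ri by (intro exI[of _ "d - k"]) auto
      then show ?thesis by (simp add: poly_eta_eq_0_iff)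
    qed
    then have "alg_eval scale ?p A \<rhd> \<xi> = 0"
      unfolding eig.alg_eval_act_spectral by (intro sum.neutral) simp
    then show ?thesis
      unfolding eq using 3 by (simp add: act_zero_right)
  qed
qed

lemma tau_dual_top: "\<tau>s d = poly (tau_poly \<theta>s d) (\<theta>s d) *\<^sub>A Es d"
proof -
  have "\<tau>s d = (\<Sum>k\<le>d. poly (tau_poly \<theta>s d) (\<theta>s k) *\<^sub>A Es k)"
    by (rule dual.alg_eval_spectral)
  also have "\<dots> = (\<Sum>k\<in>{d}. poly (tau_poly \<theta>s d) (\<theta>s k) *\<^sub>A Es k)"
    by (intro sum.mono_neutral_right) (auto simp: poly_tau_eq_0_iff nat_less_le)
  finally show ?thesis by simp
qed

lemma split_product_top:
  assumes phi: "split_sequence phi"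
  shows "poly (tau_poly \<theta>s d) (\<theta>s d) *\<^sub>V (E d \<rhd> (Es d \<rhd> (A ^ d \<rhd> \<xi>))) = (\<Prod>k=1..d. phi k) *\<^sub>V (E d \<rhd> \<xi>)"
  using split_product[OF phi, of d d] top_component[OF eta_poly_monic]
  by (simp add: tau_dual_top act_scale_left act_scale_right)

end

section \<open>The identities\<close>

text \<open>
  The common shape of the identities; it reduces them to the action of the operators \<open>M\<^sub>r\<close> on a
  single vector, whatever the family \<open>X\<close>.
\<close>
lemma (in left_module) select_summand:
  assumes i: "i \<le> d" and M: "\<And>r. r \<le> d \<Longrightarrow> (c * a r) *\<^sub>V (M r \<rhd> w) = (if i = r then \<zeta> else 0)"
  shows "(c *\<^sub>A (\<Sum>r\<le>d. a r *\<^sub>A (X r * M r))) \<rhd> w = X i \<rhd> \<zeta>"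
proof -
  have "(c *\<^sub>A (\<Sum>r\<le>d. a r *\<^sub>A (X r * M r))) \<rhd> w = (\<Sum>r\<le>d. X r \<rhd> ((c * a r) *\<^sub>V (M r \<rhd> w)))"
    by (simp add: act_scale_left act_scale_right act_sum_left act_mult V.scale_sum_right)
  also have "\<dots> = X i \<rhd> \<zeta>"
    using i by (simp add: M act_zero_right if_distrib[of "act _"] cong: if_cong)
  finally show ?thesis .
qed

theorem theorem15p1:
  fixes scaleA :: "'k::field \<Rightarrow> 'a::ring_1 \<Rightarrow> 'a" (infixr "*\<^sub>A" 75)
    and d :: nat
    and \<psi> :: "'a \<Rightarrow> 'k mat"
    and scaleV :: "'k \<Rightarrow> 'v::ab_group_add \<Rightarrow> 'v" (infixr "*\<^sub>V" 75)
    and act :: "'a \<Rightarrow> 'v \<Rightarrow> 'v" (infixr "\<rhd>" 70)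
    and A As :: 'a and E Es :: "nat \<Rightarrow> 'a"
    and \<theta> \<theta>s vphi phi :: "nat \<Rightarrow> 'k"
    and dagger :: "'a \<Rightarrow> 'a"
    and B :: "'v \<Rightarrow> 'v \<Rightarrow> 'k" ("\<langle>_, _\<rangle>")
    and \<xi>\<^sub>0 \<xi>\<^sub>d \<xi>s\<^sub>0 \<xi>s\<^sub>d :: 'v
  assumes "irreducible_left_module scaleA d \<psi> scaleV act"
    and "leonard_system scaleA d \<psi> A E As Es"
    and "parameter_array scaleA d \<psi> A E As Es \<theta> \<theta>s vphi phi"
    and "antiautomorphism scaleA dagger" and "dagger A = A" and "dagger As = As"
    and "bilinear_form scaleV B" and "\<exists>u v. \<langle>u, v\<rangle> \<noteq> 0"
    and "\<And>X u v. \<langle>X \<rhd> u, v\<rangle> = \<langle>u, dagger X \<rhd> v\<rangle>"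
    and "\<xi>\<^sub>0 \<in> range (act (E 0))" and "\<xi>\<^sub>0 \<noteq> 0"
    and "\<xi>\<^sub>d \<in> range (act (E d))" and "\<xi>\<^sub>d \<noteq> 0"
    and "\<xi>s\<^sub>0 \<in> range (act (Es 0))" and "\<xi>s\<^sub>0 \<noteq> 0"
    and "\<xi>s\<^sub>d \<in> range (act (Es d))" and "\<xi>s\<^sub>d \<noteq> 0"
  shows
   "let tr = alg_trace \<psi>;
        \<tau> = (\<lambda>i. alg_eval scaleA (tau_poly \<theta> i) A);
        \<eta> = (\<lambda>i. alg_eval scaleA (eta_poly d \<theta> i) A);
        \<tau>s = (\<lambda>i. alg_eval scaleA (tau_poly \<theta>s i) As);
        \<eta>s = (\<lambda>i. alg_eval scaleA (eta_poly d \<theta>s i) As);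
        t = poly (tau_poly \<theta>s d) (\<theta>s d);
        vphi_all = (\<Prod>i=1..d. vphi i);
        phi_all = (\<Prod>i=1..d. phi i)
    in
      (\<forall>X \<in> {E, (\<lambda>i. E (d - i)), \<tau>, (\<lambda>i. \<tau> (d - i)), \<eta>, (\<lambda>i. \<eta> (d - i))}. \<forall>i\<le>d.
          ((1 / tr (E d * Es 0)) *\<^sub>A (\<Sum>r\<le>d. (1 / (\<Prod>k=1..r. phi k)) *\<^sub>A (X r * Es 0 * E d * \<tau>s r))) \<rhd> (\<eta> i \<rhd> \<xi>s\<^sub>0)
            = X i \<rhd> \<xi>s\<^sub>0 \<and>
          ((t / phi_all * (\<langle>\<xi>\<^sub>d, \<xi>s\<^sub>d\<rangle> / \<langle>\<xi>\<^sub>d, \<xi>s\<^sub>0\<rangle>)) *\<^sub>A (\<Sum>r\<le>d. X r * Es d * \<tau> (d - r))) \<rhd> (\<eta> i \<rhd> \<xi>s\<^sub>0)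
            = X i \<rhd> \<xi>s\<^sub>d \<and>
          ((1 / tr (E d * Es 0)) *\<^sub>A (\<Sum>r\<le>d. (1 / (\<Prod>k=1..r. phi k)) *\<^sub>A (X (d - r) * Es 0 * E d * \<tau>s r))) \<rhd> (\<eta> (d - i) \<rhd> \<xi>s\<^sub>0)
            = X i \<rhd> \<xi>s\<^sub>0 \<and>
          ((t / phi_all * (\<langle>\<xi>\<^sub>d, \<xi>s\<^sub>d\<rangle> / \<langle>\<xi>\<^sub>d, \<xi>s\<^sub>0\<rangle>)) *\<^sub>A (\<Sum>r\<le>d. X (d - r) * Es d * \<tau> (d - r))) \<rhd> (\<eta> (d - i) \<rhd> \<xi>s\<^sub>0)
            = X i \<rhd> \<xi>s\<^sub>d) \<and>
      (\<forall>X \<in> {Es, (\<lambda>i. Es (d - i)), \<tau>s, (\<lambda>i. \<tau>s (d - i)), \<eta>s, (\<lambda>i. \<eta>s (d - i))}. \<forall>i\<le>d.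
          ((t / vphi_all * (\<langle>\<xi>\<^sub>0, \<xi>\<^sub>0\<rangle> / \<langle>\<xi>\<^sub>0, \<xi>s\<^sub>0\<rangle>)) *\<^sub>A (\<Sum>r\<le>d. X r * E 0 * Es d * \<tau> (d - r))) \<rhd> (\<eta> i \<rhd> \<xi>s\<^sub>0)
            = X i \<rhd> \<xi>\<^sub>0 \<and>
          ((\<langle>\<xi>\<^sub>d, \<xi>\<^sub>d\<rangle> / \<langle>\<xi>\<^sub>d, \<xi>s\<^sub>0\<rangle>) *\<^sub>A (\<Sum>r\<le>d. (1 / (\<Prod>k=1..r. phi k)) *\<^sub>A (X r * E d * \<tau>s r))) \<rhd> (\<eta> i \<rhd> \<xi>s\<^sub>0)
            = X i \<rhd> \<xi>\<^sub>d \<and>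
          ((t / vphi_all * (\<langle>\<xi>\<^sub>0, \<xi>\<^sub>0\<rangle> / \<langle>\<xi>\<^sub>0, \<xi>s\<^sub>0\<rangle>)) *\<^sub>A (\<Sum>r\<le>d. X (d - r) * E 0 * Es d * \<tau> (d - r))) \<rhd> (\<eta> (d - i) \<rhd> \<xi>s\<^sub>0)
            = X i \<rhd> \<xi>\<^sub>0 \<and>
          ((\<langle>\<xi>\<^sub>d, \<xi>\<^sub>d\<rangle> / \<langle>\<xi>\<^sub>d, \<xi>s\<^sub>0\<rangle>) *\<^sub>A (\<Sum>r\<le>d. (1 / (\<Prod>k=1..r. phi k)) *\<^sub>A (X (d - r) * E d * \<tau>s r))) \<rhd> (\<eta> (d - i) \<rhd> \<xi>s\<^sub>0)
            = X i \<rhd> \<xi>\<^sub>d)"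
proof -
  interpret irreducible_left_module scaleA d \<psi> scaleV act by fact
  interpret L: leonard_system scaleA d \<psi> A E As Es by fact
  have eigA: "eigenvalue_sequence scaleA d \<psi> A E \<theta>"
    and eigAs: "eigenvalue_sequence scaleA d \<psi> As Es \<theta>s"
    using assms(3) by (auto simp: parameter_array_def)
  interpret resA: idempotent_resolution scaleA d \<psi> A E \<theta>
    by (rule eigenvalue_sequence_resolution[OF eigA])
  interpret resAs: idempotent_resolution scaleA d \<psi> As Es \<theta>s
    by (rule eigenvalue_sequence_resolution[OF eigAs])
  interpret modA: module_resolution scaleA d \<psi> scaleV act A E \<theta> ..
  interpret modAs: module_resolution scaleA d \<psi> scaleV act As Es \<theta>s ..
  have \<xi>0: "E 0 \<rhd> \<xi>\<^sub>0 = \<xi>\<^sub>0" and \<xi>d: "E d \<rhd> \<xi>\<^sub>d = \<xi>\<^sub>d"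
    and \<xi>s0: "Es 0 \<rhd> \<xi>s\<^sub>0 = \<xi>s\<^sub>0" and \<xi>sd: "Es d \<rhd> \<xi>s\<^sub>d = \<xi>s\<^sub>d"
    using assms(10,12,14,16) by (simp_all add: modA.idempotent_range modAs.idempotent_range)
  interpret leonard_module scaleA d \<psi> scaleV act A E \<theta> As Es \<theta>s \<xi>s\<^sub>0
  proof unfold_locales
    show "E i * As * E j = 0" if "i \<le> d" "Suc j < i" for i j
      using that by (intro L.tridiagonal_zero) auto
    show "E (Suc j) * As * E j \<noteq> 0" if "Suc j \<le> d" for j
      using that by (intro L.tridiagonal_nonzero) auto
    show "Es i * A * Es j = 0" if "i \<le> d" "Suc j < i" for i j
      using that by (intro L.dual_tridiagonal_zero) auto
    show "Es (Suc j) * A * Es j \<noteq> 0" if "Suc j \<le> d" for j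
      using that by (intro L.dual_tridiagonal_nonzero) auto
    show "E i * As * E j = 0" if "j \<le> d" "Suc i < j" for i j
      using that by (intro L.tridiagonal_zero) auto
    show "E i * As * E (Suc i) \<noteq> 0" if "Suc i \<le> d" for i
      using that by (intro L.tridiagonal_nonzero) auto
  qed (use \<xi>s0 assms(15) in auto)
  interpret rev: leonard_module scaleA d \<psi> scaleV act A "\<lambda>i. E (d - i)" "\<lambda>i. \<theta> (d - i)" As Es \<theta>s \<xi>s\<^sub>0
    by (rule reverse)
  have phi: "split_sequence phi"
    using assms(3) by (auto simp: parameter_array_def split_sequence_def)
  have vphi: "rev.split_sequence vphi"
    using assms(3) by (auto simp: parameter_array_def rev.split_sequence_def eta_poly_reverse)

  define t where "t = poly (tau_poly \<theta>s d) (\<theta>s d)"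
  let ?phi = "\<lambda>r. \<Prod>k=1..r. phi k" and ?vphi = "\<Prod>k=1..d. vphi k"
  \<comment> \<open>The common value of \<open>E\<^sup>*\<^sub>d \<tau>\<^sub>d\<^sub>-\<^sub>i(A) \<eta>\<^sub>i(A) \<xi>\<^sup>*\<^sub>0\<close>, which spans the line \<open>E\<^sup>*\<^sub>dV\<close>.\<close>
  define y where "y = Es d \<rhd> (A ^ d \<rhd> \<xi>s\<^sub>0)"
  note phi_nz = split_product_nonzero[OF phi]
  have vphi_nz: "?vphi \<noteq> 0"
    using rev.split_product_nonzero[OF vphi, of d] by simp
  have tr_nz: "tr (E d * Es 0) \<noteq> 0"
    using rev.trace_bottom_nonzero by simp
  have y_phi: "t *\<^sub>V (E d \<rhd> y) = ?phi d *\<^sub>V (E d \<rhd> \<xi>s\<^sub>0)"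
    using split_product_top[OF phi] by (simp add: t_def y_def)
  have y_vphi: "t *\<^sub>V (E 0 \<rhd> y) = ?vphi *\<^sub>V (E 0 \<rhd> \<xi>s\<^sub>0)"
    using rev.split_product_top[OF vphi] by (simp add: t_def y_def)

  note form = assms(7,8,9,5)
  have sq0: "\<langle>\<xi>\<^sub>0, \<xi>\<^sub>0\<rangle> \<noteq> 0" and sqd: "\<langle>\<xi>\<^sub>d, \<xi>\<^sub>d\<rangle> \<noteq> 0"
    using modA.form_anisotropic[OF form] \<xi>0 \<xi>d assms(11,13) by auto
  have comp0: "E 0 \<rhd> v = (\<langle>\<xi>\<^sub>0, v\<rangle> / \<langle>\<xi>\<^sub>0, \<xi>\<^sub>0\<rangle>) *\<^sub>V \<xi>\<^sub>0" for v
    using modA.component_eq_form[OF form] \<xi>0 assms(11) by auto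
  have compd: "E d \<rhd> v = (\<langle>\<xi>\<^sub>d, v\<rangle> / \<langle>\<xi>\<^sub>d, \<xi>\<^sub>d\<rangle>) *\<^sub>V \<xi>\<^sub>d" for v
    using modA.component_eq_form[OF form] \<xi>d assms(13) by auto
  have ip0: "\<langle>\<xi>\<^sub>0, \<xi>s\<^sub>0\<rangle> \<noteq> 0" and ipd: "\<langle>\<xi>\<^sub>d, \<xi>s\<^sub>0\<rangle> \<noteq> 0"
    using eig_component_nonzero[of 0] eig_component_nonzero[of d] comp0[of \<xi>s\<^sub>0] compd[of \<xi>s\<^sub>0] by auto

  \<comment> \<open>Pairing \<open>y_phi\<close> with \<open>\<xi>\<^sub>d\<close> determines \<open>c\<close> and shows that \<open>\<langle>\<xi>\<^sub>d, \<xi>\<^sup>*\<^sub>d\<rangle>\<close> is nonzero.\<close>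
  obtain c where c: "y = c *\<^sub>V \<xi>s\<^sub>d"
    using modAs.idempotent_line[of d \<xi>s\<^sub>d "A ^ d \<rhd> \<xi>s\<^sub>0"] \<xi>sd assms(17) unfolding y_def by auto
  have c_eq: "t * (c * \<langle>\<xi>\<^sub>d, \<xi>s\<^sub>d\<rangle>) = ?phi d * \<langle>\<xi>\<^sub>d, \<xi>s\<^sub>0\<rangle>"
    using y_phi sqd assms(13) unfolding c compd
    by (simp add: modA.form_scale_right[OF form])
  then have ipsd: "\<langle>\<xi>\<^sub>d, \<xi>s\<^sub>d\<rangle> \<noteq> 0"
    using phi_nz[of d] ipd by auto

  have core1: "(1 / tr (E d * Es 0) * (1 / ?phi r)) *\<^sub>V ((Es 0 * (E d * \<tau>s r)) \<rhd> (\<eta> i \<rhd> \<xi>s\<^sub>0))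
      = (if i = r then \<xi>s\<^sub>0 else 0)" if "i \<le> d" "r \<le> d" for i r
    using that tr_nz phi_nz[of r] dual_component[of "E d"]
    by (simp add: act_mult split_product[OF phi] act_scale_right act_zero_right)
  have core2: "(t / ?phi d * (\<langle>\<xi>\<^sub>d, \<xi>s\<^sub>d\<rangle> / \<langle>\<xi>\<^sub>d, \<xi>s\<^sub>0\<rangle>) * 1) *\<^sub>V ((Es d * \<tau> (d - r)) \<rhd> (\<eta> i \<rhd> \<xi>s\<^sub>0))
      = (if i = r then \<xi>s\<^sub>d else 0)" if "i \<le> d" "r \<le> d" for i r
  proof -
    have "t / ?phi d * (\<langle>\<xi>\<^sub>d, \<xi>s\<^sub>d\<rangle> / \<langle>\<xi>\<^sub>d, \<xi>s\<^sub>0\<rangle>) * c = 1"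
      using c_eq phi_nz[of d] ipd by (simp add: field_simps)
    then show ?thesis
      using that by (simp add: act_mult top_tau_eta c flip: y_def)
  qed
  have core3: "(t / ?vphi * (\<langle>\<xi>\<^sub>0, \<xi>\<^sub>0\<rangle> / \<langle>\<xi>\<^sub>0, \<xi>s\<^sub>0\<rangle>) * 1) *\<^sub>V ((E 0 * (Es d * \<tau> (d - r))) \<rhd> (\<eta> i \<rhd> \<xi>s\<^sub>0))
      = (if i = r then \<xi>\<^sub>0 else 0)" if "i \<le> d" "r \<le> d" for i r
  proof -
    have "(t / ?vphi * (\<langle>\<xi>\<^sub>0, \<xi>\<^sub>0\<rangle> / \<langle>\<xi>\<^sub>0, \<xi>s\<^sub>0\<rangle>)) *\<^sub>V (E 0 \<rhd> y)
        = (\<langle>\<xi>\<^sub>0, \<xi>\<^sub>0\<rangle> / \<langle>\<xi>\<^sub>0, \<xi>s\<^sub>0\<rangle> / ?vphi) *\<^sub>V (t *\<^sub>V (E 0 \<rhd> y))"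
      by (simp add: mult.commute)
    also have "\<dots> = \<xi>\<^sub>0"
      unfolding y_vphi comp0[of \<xi>s\<^sub>0] using vphi_nz sq0 ip0 by simp
    finally show ?thesis
      using that by (simp add: act_mult top_tau_eta act_zero_right flip: y_def)
  qed
  have core4: "(\<langle>\<xi>\<^sub>d, \<xi>\<^sub>d\<rangle> / \<langle>\<xi>\<^sub>d, \<xi>s\<^sub>0\<rangle> * (1 / ?phi r)) *\<^sub>V ((E d * \<tau>s r) \<rhd> (\<eta> i \<rhd> \<xi>s\<^sub>0))
      = (if i = r then \<xi>\<^sub>d else 0)" if "i \<le> d" "r \<le> d" for i r
    using that phi_nz[of r] sqd ipd
    by (simp add: act_mult split_product[OF phi] compd[of \<xi>s\<^sub>0])

  have first: "((1 / tr (E d * Es 0)) *\<^sub>A (\<Sum>r\<le>d. (1 / ?phi r) *\<^sub>A (X r * Es 0 * E d * \<tau>s r))) \<rhd> (\<eta> i \<rhd> \<xi>s\<^sub>0)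
      = X i \<rhd> \<xi>s\<^sub>0"
    and second: "((t / ?phi d * (\<langle>\<xi>\<^sub>d, \<xi>s\<^sub>d\<rangle> / \<langle>\<xi>\<^sub>d, \<xi>s\<^sub>0\<rangle>)) *\<^sub>A (\<Sum>r\<le>d. X r * Es d * \<tau> (d - r))) \<rhd> (\<eta> i \<rhd> \<xi>s\<^sub>0)
      = X i \<rhd> \<xi>s\<^sub>d"
    and third: "((t / ?vphi * (\<langle>\<xi>\<^sub>0, \<xi>\<^sub>0\<rangle> / \<langle>\<xi>\<^sub>0, \<xi>s\<^sub>0\<rangle>)) *\<^sub>A (\<Sum>r\<le>d. X r * E 0 * Es d * \<tau> (d - r))) \<rhd> (\<eta> i \<rhd> \<xi>s\<^sub>0)
      = X i \<rhd> \<xi>\<^sub>0"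
    and fourth: "((\<langle>\<xi>\<^sub>d, \<xi>\<^sub>d\<rangle> / \<langle>\<xi>\<^sub>d, \<xi>s\<^sub>0\<rangle>) *\<^sub>A (\<Sum>r\<le>d. (1 / ?phi r) *\<^sub>A (X r * E d * \<tau>s r))) \<rhd> (\<eta> i \<rhd> \<xi>s\<^sub>0)
      = X i \<rhd> \<xi>\<^sub>d"
    if "i \<le> d" for X i
    using select_summand[OF that core1[OF that], of X] select_summand[OF that core2[OF that], of X]
      select_summand[OF that core3[OF that], of X] select_summand[OF that core4[OF that], of X]
    by (simp_all add: mult.assoc)
  show ?thesis
    unfolding Let_def t_def[symmetric]
  proof (intro conjI ballI allI impI, goal_cases)
    case (1 X i) then show ?case using first[of i X] by simp
  next
    case (2 X i) then show ?case using second[of i X] by simp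
  next
    case (3 X i) then show ?case using first[of "d - i" "\<lambda>r. X (d - r)"] by simp
  next
    case (4 X i) then show ?case using second[of "d - i" "\<lambda>r. X (d - r)"] by simp
  next
    case (5 X i) then show ?case using third[of i X] by simp
  next
    case (6 X i) then show ?case using fourth[of i X] by simp
  next
    case (7 X i) then show ?case using third[of "d - i" "\<lambda>r. X (d - r)"] by simp
  next
    case (8 X i) then show ?case using fourth[of "d - i" "\<lambda>r. X (d - r)"] by simp
  qed
qed

end
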